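(* Let $\Bbbk$ be a commutative ring and let $M$ be a $\Bbbk$-module such that the map $$\partial:\Lambda^2M\to M\otimes M,\qquad\partial(a\wedge b)=a\otimes b-b\otimes a,$$ is not injective. Let $\mathfrak g=M\oplus\Lambda^2M$ be the Lie algebra over $\Bbbk$ with bracket determined by $[a,b]=a\wedge b$ for $a,b\in M$ and $[\alpha,-]=[-,\alpha]=0$ for $\alpha\in\Lambda^2M$. Then the canonical map $\varphi:\mathfrak g\to U\mathfrak g$ to the universal enveloping algebra is not injective.
   Context: Tensor and exterior powers are over $\Bbbk$. *)

theory Defs
  imports "HOL-Algebra.QuotRing" "HOL-Algebra.Module" "HOL-Library.FuncSet"
begin

section \<open>Modules: linear maps, quotients, free modules\<close>

definition lin_hom :: "('k, 'c) ring_scheme \<Rightarrow> ('k, 'a, 'd) module_scheme \<Rightarrow> ('k, 'b, 'e) module_scheme \<Rightarrow> ('a \<Rightarrow> 'b) set"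
  where "lin_hom R M N = {h \<in> carrier M \<rightarrow> carrier N.
     (\<forall>x\<in>carrier M. \<forall>y\<in>carrier M. h (x \<oplus>\<^bsub>M\<^esub> y) = h x \<oplus>\<^bsub>N\<^esub> h y) \<and>
     (\<forall>r\<in>carrier R. \<forall>x\<in>carrier M. h (r \<odot>\<^bsub>M\<^esub> x) = r \<odot>\<^bsub>N\<^esub> h x)}"

definition submod_gen :: "('k, 'c) ring_scheme \<Rightarrow> ('k, 'a, 'd) module_scheme \<Rightarrow> 'a set \<Rightarrow> 'a set"
  where "submod_gen R M S = \<Inter>{N. submodule N R M \<and> S \<subseteq> N}"

text \<open>Records of type \<^type>\<open>module\<close> that only stand for a module leave the (irrelevant)
  ring fields \<open>mult\<close> and \<open>one\<close> unspecified.\<close>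

definition quot_module :: "('k, 'a, 'd) module_scheme \<Rightarrow> 'a set \<Rightarrow> ('k, 'a set) module"
  where "quot_module M N =
    \<lparr>carrier = a_rcosets\<^bsub>M\<^esub> N, mult = undefined, one = undefined, zero = N, add = set_add M,
     smult = (\<lambda>r C. \<Union>x\<in>C. N +>\<^bsub>M\<^esub> (r \<odot>\<^bsub>M\<^esub> x))\<rparr>"

definition free_module :: "('k, 'c) ring_scheme \<Rightarrow> 'x set \<Rightarrow> ('k, 'x \<Rightarrow> 'k) module"
  where "free_module R X =
    \<lparr>carrier = {f. (\<forall>x. f x \<in> carrier R) \<and> (\<forall>x. x \<notin> X \<longrightarrow> f x = \<zero>\<^bsub>R\<^esub>) \<and> finite {x. f x \<noteq> \<zero>\<^bsub>R\<^esub>}},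
     mult = undefined, one = undefined,
     zero = (\<lambda>x. \<zero>\<^bsub>R\<^esub>), add = (\<lambda>f g x. f x \<oplus>\<^bsub>R\<^esub> g x),
     smult = (\<lambda>r f x. r \<otimes>\<^bsub>R\<^esub> f x)\<rparr>"

definition free_gen :: "('k, 'c) ring_scheme \<Rightarrow> 'x \<Rightarrow> 'x \<Rightarrow> 'k"
  where "free_gen R x = (\<lambda>y. if y = x then \<one>\<^bsub>R\<^esub> else \<zero>\<^bsub>R\<^esub>)"


section \<open>Tensor product, exterior square and the map \<open>\<partial>\<close>\<close>

definition tensor_rels ::
  "('k, 'c) ring_scheme \<Rightarrow> ('k, 'a, 'd) module_scheme \<Rightarrow> ('k, 'b, 'e) module_scheme \<Rightarrow> ('a \<times> 'b \<Rightarrow> 'k) set"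
  where "tensor_rels R M N = (let F = free_module R (carrier M \<times> carrier N); e = free_gen R in
      {e (x \<oplus>\<^bsub>M\<^esub> x', y) \<ominus>\<^bsub>F\<^esub> (e (x, y) \<oplus>\<^bsub>F\<^esub> e (x', y)) | x x' y.
         x \<in> carrier M \<and> x' \<in> carrier M \<and> y \<in> carrier N} \<union>
      {e (x, y \<oplus>\<^bsub>N\<^esub> y') \<ominus>\<^bsub>F\<^esub> (e (x, y) \<oplus>\<^bsub>F\<^esub> e (x, y')) | x y y'.
         x \<in> carrier M \<and> y \<in> carrier N \<and> y' \<in> carrier N} \<union>
      {e (r \<odot>\<^bsub>M\<^esub> x, y) \<ominus>\<^bsub>F\<^esub> r \<odot>\<^bsub>F\<^esub> e (x, y) | r x y.
         r \<in> carrier R \<and> x \<in> carrier M \<and> y \<in> carrier N} \<union>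
      {e (x, r \<odot>\<^bsub>N\<^esub> y) \<ominus>\<^bsub>F\<^esub> r \<odot>\<^bsub>F\<^esub> e (x, y) | r x y.
         r \<in> carrier R \<and> x \<in> carrier M \<and> y \<in> carrier N})"

definition tensor_submod ::
  "('k, 'c) ring_scheme \<Rightarrow> ('k, 'a, 'd) module_scheme \<Rightarrow> ('k, 'b, 'e) module_scheme \<Rightarrow> ('a \<times> 'b \<Rightarrow> 'k) set"
  where "tensor_submod R M N =
    submod_gen R (free_module R (carrier M \<times> carrier N)) (tensor_rels R M N)"

definition tensor_prod ::
  "('k, 'c) ring_scheme \<Rightarrow> ('k, 'a, 'd) module_scheme \<Rightarrow> ('k, 'b, 'e) module_scheme
    \<Rightarrow> ('k, ('a \<times> 'b \<Rightarrow> 'k) set) module"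
  where "tensor_prod R M N =
    quot_module (free_module R (carrier M \<times> carrier N)) (tensor_submod R M N)"

definition tensor ::
  "('k, 'c) ring_scheme \<Rightarrow> ('k, 'a, 'd) module_scheme \<Rightarrow> ('k, 'b, 'e) module_scheme
    \<Rightarrow> 'a \<Rightarrow> 'b \<Rightarrow> ('a \<times> 'b \<Rightarrow> 'k) set"
  where "tensor R M N x y =
    tensor_submod R M N +>\<^bsub>free_module R (carrier M \<times> carrier N)\<^esub> free_gen R (x, y)"

definition ext_submod ::
  "('k, 'c) ring_scheme \<Rightarrow> ('k, 'a, 'd) module_scheme \<Rightarrow> ('a \<times> 'a \<Rightarrow> 'k) set set"
  where "ext_submod R M = submod_gen R (tensor_prod R M M) {tensor R M M x x | x. x \<in> carrier M}"

definition ext_square ::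
  "('k, 'c) ring_scheme \<Rightarrow> ('k, 'a, 'd) module_scheme \<Rightarrow> ('k, ('a \<times> 'a \<Rightarrow> 'k) set set) module"
  where "ext_square R M = quot_module (tensor_prod R M M) (ext_submod R M)"

definition wedge ::
  "('k, 'c) ring_scheme \<Rightarrow> ('k, 'a, 'd) module_scheme \<Rightarrow> 'a \<Rightarrow> 'a \<Rightarrow> ('a \<times> 'a \<Rightarrow> 'k) set set"
  where "wedge R M x y = ext_submod R M +>\<^bsub>tensor_prod R M M\<^esub> tensor R M M x y"

text \<open>Existence and uniqueness of this map are proved in \<open>wedge_bdry_unique\<close> below.\<close>

definition wedge_bdry ::
  "('k, 'c) ring_scheme \<Rightarrow> ('k, 'a, 'd) module_scheme
    \<Rightarrow> ('a \<times> 'a \<Rightarrow> 'k) set set \<Rightarrow> ('a \<times> 'a \<Rightarrow> 'k) set"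
  where "wedge_bdry R M = (THE D.
     D \<in> lin_hom R (ext_square R M) (tensor_prod R M M) \<and>
     D \<in> extensional (carrier (ext_square R M)) \<and>
     (\<forall>a\<in>carrier M. \<forall>b\<in>carrier M.
        D (wedge R M a b) = tensor R M M a b \<ominus>\<^bsub>tensor_prod R M M\<^esub> tensor R M M b a))"


section \<open>Lie algebras and the Lie algebra \<open>M \<oplus> \<Lambda>\<^sup>2M\<close>\<close>

record ('k, 'a) lie_ring = "('k, 'a) module" +
  bracket :: "'a \<Rightarrow> 'a \<Rightarrow> 'a"

locale lie_algebra = module R L for R (structure) and L (structure) +
  assumes bracket_closed:
      "\<lbrakk>x \<in> carrier L; y \<in> carrier L\<rbrakk> \<Longrightarrow> bracket L x y \<in> carrier L"
    and bracket_add_l: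
      "\<lbrakk>x \<in> carrier L; x' \<in> carrier L; y \<in> carrier L\<rbrakk> \<Longrightarrow>
       bracket L (x \<oplus>\<^bsub>L\<^esub> x') y = bracket L x y \<oplus>\<^bsub>L\<^esub> bracket L x' y"
    and bracket_add_r:
      "\<lbrakk>x \<in> carrier L; y \<in> carrier L; y' \<in> carrier L\<rbrakk> \<Longrightarrow>
       bracket L x (y \<oplus>\<^bsub>L\<^esub> y') = bracket L x y \<oplus>\<^bsub>L\<^esub> bracket L x y'"
    and bracket_smult_l:
      "\<lbrakk>r \<in> carrier R; x \<in> carrier L; y \<in> carrier L\<rbrakk> \<Longrightarrow>
       bracket L (r \<odot>\<^bsub>L\<^esub> x) y = r \<odot>\<^bsub>L\<^esub> bracket L x y"
    and bracket_smult_r: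
      "\<lbrakk>r \<in> carrier R; x \<in> carrier L; y \<in> carrier L\<rbrakk> \<Longrightarrow>
       bracket L x (r \<odot>\<^bsub>L\<^esub> y) = r \<odot>\<^bsub>L\<^esub> bracket L x y"
    and bracket_self: "x \<in> carrier L \<Longrightarrow> bracket L x x = \<zero>\<^bsub>L\<^esub>"
    and jacobi:
      "\<lbrakk>x \<in> carrier L; y \<in> carrier L; z \<in> carrier L\<rbrakk> \<Longrightarrow>
       bracket L x (bracket L y z) \<oplus>\<^bsub>L\<^esub> bracket L y (bracket L z x) \<oplus>\<^bsub>L\<^esub> bracket L z (bracket L x y) = \<zero>\<^bsub>L\<^esub>"

definition wedge_lie ::
  "('k, 'c) ring_scheme \<Rightarrow> ('k, 'a, 'd) module_scheme \<Rightarrow> ('k, 'a \<times> ('a \<times> 'a \<Rightarrow> 'k) set set) lie_ring"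
  where "wedge_lie R M = (let E = ext_square R M in
    \<lparr>carrier = carrier M \<times> carrier E, mult = undefined, one = undefined,
     zero = (\<zero>\<^bsub>M\<^esub>, \<zero>\<^bsub>E\<^esub>),
     add = (\<lambda>(a, \<alpha>) (b, \<beta>). (a \<oplus>\<^bsub>M\<^esub> b, \<alpha> \<oplus>\<^bsub>E\<^esub> \<beta>)),
     smult = (\<lambda>r (a, \<alpha>). (r \<odot>\<^bsub>M\<^esub> a, r \<odot>\<^bsub>E\<^esub> \<alpha>)),
     bracket = (\<lambda>(a, \<alpha>) (b, \<beta>). (\<zero>\<^bsub>M\<^esub>, wedge R M a b))\<rparr>)"


section \<open>Tensor algebra and universal enveloping algebra\<close>

text \<open>The library locale \<^locale>\<open>algebra\<close> is restricted to commutative algebras.\<close>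

locale assoc_algebra = module R A + A?: ring A for R (structure) and A (structure) +
  assumes smult_mult_l:
      "\<lbrakk>r \<in> carrier R; x \<in> carrier A; y \<in> carrier A\<rbrakk> \<Longrightarrow>
       (r \<odot>\<^bsub>A\<^esub> x) \<otimes>\<^bsub>A\<^esub> y = r \<odot>\<^bsub>A\<^esub> (x \<otimes>\<^bsub>A\<^esub> y)"
    and smult_mult_r:
      "\<lbrakk>r \<in> carrier R; x \<in> carrier A; y \<in> carrier A\<rbrakk> \<Longrightarrow>
       x \<otimes>\<^bsub>A\<^esub> (r \<odot>\<^bsub>A\<^esub> y) = r \<odot>\<^bsub>A\<^esub> (x \<otimes>\<^bsub>A\<^esub> y)"

definition quot_algebra :: "('k, 'a, 'd) module_scheme \<Rightarrow> 'a set \<Rightarrow> ('k, 'a set) module"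
  where "quot_algebra A I =
    (quot_module A I)\<lparr>mult := mult (A Quot I), one := one (A Quot I)\<rparr>"

text \<open>Noncommutative polynomials in the set \<open>X\<close> of indeterminates, as finitely supported
  functions on the words over \<open>X\<close>.\<close>

definition free_algebra :: "('k, 'c) ring_scheme \<Rightarrow> 'x set \<Rightarrow> ('k, 'x list \<Rightarrow> 'k) module"
  where "free_algebra R X = (free_module R (lists X))
    \<lparr>mult := (\<lambda>f g w. \<Oplus>\<^bsub>R\<^esub>p\<in>{p. fst p @ snd p = w}. f (fst p) \<otimes>\<^bsub>R\<^esub> g (snd p)),
     one := free_gen R []\<rparr>"

text \<open>The tensor algebra of a module \<open>L\<close>: in the free algebra on the set \<open>L\<close>, the two-sided ideal
  generated by the linearity relations is spanned by all multilinearity relations between words, so that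
  the words of length \<open>n\<close> contribute precisely the \<open>n\<close>-th tensor power of \<open>L\<close>.\<close>

definition tensor_alg_rels ::
  "('k, 'c) ring_scheme \<Rightarrow> ('k, 'a, 'd) module_scheme \<Rightarrow> ('a list \<Rightarrow> 'k) set"
  where "tensor_alg_rels R L = (let A = free_algebra R (carrier L); e = (\<lambda>x. free_gen R [x]) in
      {e (x \<oplus>\<^bsub>L\<^esub> y) \<ominus>\<^bsub>A\<^esub> (e x \<oplus>\<^bsub>A\<^esub> e y) | x y. x \<in> carrier L \<and> y \<in> carrier L} \<union>
      {e (r \<odot>\<^bsub>L\<^esub> x) \<ominus>\<^bsub>A\<^esub> r \<odot>\<^bsub>A\<^esub> e x | r x. r \<in> carrier R \<and> x \<in> carrier L})"

definition tensor_alg_ideal ::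
  "('k, 'c) ring_scheme \<Rightarrow> ('k, 'a, 'd) module_scheme \<Rightarrow> ('a list \<Rightarrow> 'k) set"
  where "tensor_alg_ideal R L = Idl\<^bsub>free_algebra R (carrier L)\<^esub> (tensor_alg_rels R L)"

definition tensor_alg ::
  "('k, 'c) ring_scheme \<Rightarrow> ('k, 'a, 'd) module_scheme \<Rightarrow> ('k, ('a list \<Rightarrow> 'k) set) module"
  where "tensor_alg R L = quot_algebra (free_algebra R (carrier L)) (tensor_alg_ideal R L)"

definition tensor_alg_incl ::
  "('k, 'c) ring_scheme \<Rightarrow> ('k, 'a, 'd) module_scheme \<Rightarrow> 'a \<Rightarrow> ('a list \<Rightarrow> 'k) set"
  where "tensor_alg_incl R L x =
    tensor_alg_ideal R L +>\<^bsub>free_algebra R (carrier L)\<^esub> free_gen R [x]"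

definition uea_ideal ::
  "('k, 'c) ring_scheme \<Rightarrow> ('k, 'a, 'd) lie_ring_scheme \<Rightarrow> ('a list \<Rightarrow> 'k) set set"
  where "uea_ideal R L = (let T = tensor_alg R L; \<iota> = tensor_alg_incl R L in
    Idl\<^bsub>T\<^esub> {\<iota> x \<otimes>\<^bsub>T\<^esub> \<iota> y \<ominus>\<^bsub>T\<^esub> \<iota> y \<otimes>\<^bsub>T\<^esub> \<iota> x \<ominus>\<^bsub>T\<^esub> \<iota> (bracket L x y) | x y.
           x \<in> carrier L \<and> y \<in> carrier L})"

definition uea ::
  "('k, 'c) ring_scheme \<Rightarrow> ('k, 'a, 'd) lie_ring_scheme \<Rightarrow> ('k, ('a list \<Rightarrow> 'k) set set) module"
  where "uea R L = quot_algebra (tensor_alg R L) (uea_ideal R L)"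

definition uea_map ::
  "('k, 'c) ring_scheme \<Rightarrow> ('k, 'a, 'd) lie_ring_scheme \<Rightarrow> 'a \<Rightarrow> ('a list \<Rightarrow> 'k) set set"
  where "uea_map R L x = uea_ideal R L +>\<^bsub>tensor_alg R L\<^esub> tensor_alg_incl R L x"


section \<open>Well-definedness of the constructions\<close>

lemma lin_homI:
  assumes "\<And>x. x \<in> carrier M \<Longrightarrow> h x \<in> carrier N"
    and "\<And>x y. x \<in> carrier M \<Longrightarrow> y \<in> carrier M \<Longrightarrow> h (x \<oplus>\<^bsub>M\<^esub> y) = h x \<oplus>\<^bsub>N\<^esub> h y"
    and "\<And>r x. r \<in> carrier R \<Longrightarrow> x \<in> carrier M \<Longrightarrow> h (r \<odot>\<^bsub>M\<^esub> x) = r \<odot>\<^bsub>N\<^esub> h x"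
  shows "h \<in> lin_hom R M N"
  using assms by (simp add: lin_hom_def)

lemma lin_hom_closed: "\<lbrakk>h \<in> lin_hom R M N; x \<in> carrier M\<rbrakk> \<Longrightarrow> h x \<in> carrier N"
  and lin_hom_add: "\<lbrakk>h \<in> lin_hom R M N; x \<in> carrier M; y \<in> carrier M\<rbrakk> \<Longrightarrow> h (x \<oplus>\<^bsub>M\<^esub> y) = h x \<oplus>\<^bsub>N\<^esub> h y"
  and lin_hom_smult: "\<lbrakk>h \<in> lin_hom R M N; r \<in> carrier R; x \<in> carrier M\<rbrakk> \<Longrightarrow> h (r \<odot>\<^bsub>M\<^esub> x) = r \<odot>\<^bsub>N\<^esub> h x"
  by (auto simp: lin_hom_def)

lemma lin_hom_abelian_group_hom:
  assumes "module R M" "module R N" "h \<in> lin_hom R M N"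
  shows "abelian_group_hom M N h"
proof -
  interpret M: module R M by fact
  interpret N: module R N by fact
  show ?thesis
    by (intro abelian_group_homI group_hom.intro group_hom_axioms.intro M.abelian_group_axioms
        N.abelian_group_axioms M.a_group N.a_group)
      (use assms(3) in \<open>auto simp: hom_def lin_hom_def\<close>)
qed

lemma lin_hom_zero:
  assumes "module R M" "module R N" "h \<in> lin_hom R M N"
  shows "h \<zero>\<^bsub>M\<^esub> = \<zero>\<^bsub>N\<^esub>"
  by (rule abelian_group_hom.hom_zero[OF lin_hom_abelian_group_hom[OF assms]])

lemma lin_hom_minus:
  assumes "module R M" "module R N" "h \<in> lin_hom R M N" "x \<in> carrier M" "y \<in> carrier M"
  shows "h (x \<ominus>\<^bsub>M\<^esub> y) = h x \<ominus>\<^bsub>N\<^esub> h y"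
proof -
  interpret abelian_group_hom M N h
    by (rule lin_hom_abelian_group_hom[OF assms(1-3)])
  show ?thesis using assms(4,5) by (simp add: a_minus_def)
qed

lemma submodule_kernel:
  assumes "module R M" "module R N" "h \<in> lin_hom R M N"
  shows "submodule {x \<in> carrier M. h x = \<zero>\<^bsub>N\<^esub>} R M"
proof -
  interpret M: module R M by fact
  interpret N: module R N by fact
  interpret abelian_group_hom M N h
    by (rule lin_hom_abelian_group_hom[OF assms(1-3)])
  show ?thesis
    by (rule M.submoduleI) (auto simp: lin_hom_smult[OF assms(3)])
qed

lemma submodule_submod_gen:
  assumes "module R M" "S \<subseteq> carrier M"
  shows "submodule (submod_gen R M S) R M"
proof -
  interpret M: module R M by fact
  have 1: "submodule (carrier M) R M" by (rule M.carrier_is_submodule)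
  note E = M.submoduleE
  show ?thesis
  proof (rule M.submoduleI)
    show "submod_gen R M S \<subseteq> carrier M" using 1 assms(2) by (auto simp: submod_gen_def)
    show "\<zero>\<^bsub>M\<^esub> \<in> submod_gen R M S"
      by (auto simp: submod_gen_def dest!: submodule.axioms(1) dest: subgroup.one_closed)
  qed (auto simp: submod_gen_def E(3,4,5))
qed

lemma submod_gen_incl: "S \<subseteq> submod_gen R M S"
  by (auto simp: submod_gen_def)

lemma submod_gen_least: "\<lbrakk>submodule N R M; S \<subseteq> N\<rbrakk> \<Longrightarrow> submod_gen R M S \<subseteq> N"
  by (auto simp: submod_gen_def)

lemma lin_hom_vanish_submod_gen:
  assumes "module R M" "module R N" "h \<in> lin_hom R M N"
    and "S \<subseteq> carrier M" "\<And>x. x \<in> S \<Longrightarrow> h x = \<zero>\<^bsub>N\<^esub>" "x \<in> submod_gen R M S"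
  shows "h x = \<zero>\<^bsub>N\<^esub>"
  using submod_gen_least[OF submodule_kernel[OF assms(1-3)]] assms(4-6) by blast

lemma submodule_abelian_subgroup:
  assumes "module R M" "submodule N R M"
  shows "abelian_subgroup N M"
proof -
  interpret M: module R M by fact
  show ?thesis
    by (rule abelian_subgroupI3)
       (use assms(2) in \<open>auto intro: additive_subgroupI submodule.axioms(1) M.abelian_group_axioms\<close>)
qed

lemma quot_module_smult:
  assumes "module R M" "submodule N R M" "r \<in> carrier R" "x \<in> carrier M"
  shows "r \<odot>\<^bsub>quot_module M N\<^esub> (N +>\<^bsub>M\<^esub> x) = N +>\<^bsub>M\<^esub> (r \<odot>\<^bsub>M\<^esub> x)"
proof -
  interpret M: module R M by fact
  interpret N: abelian_subgroup N M by (rule submodule_abelian_subgroup[OF assms(1,2)])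
  have "N +>\<^bsub>M\<^esub> (r \<odot>\<^bsub>M\<^esub> y) = N +>\<^bsub>M\<^esub> (r \<odot>\<^bsub>M\<^esub> x)" if y: "y \<in> N +>\<^bsub>M\<^esub> x" for y
  proof -
    obtain n where n: "n \<in> N" "y = n \<oplus>\<^bsub>M\<^esub> x" using y by (auto simp: a_r_coset_def')
    have "r \<odot>\<^bsub>M\<^esub> y = r \<odot>\<^bsub>M\<^esub> n \<oplus>\<^bsub>M\<^esub> r \<odot>\<^bsub>M\<^esub> x" using n assms by (simp add: M.smult_r_distr)
    moreover have "r \<odot>\<^bsub>M\<^esub> n \<in> N" using submodule.smult_closed[OF assms(2)] assms(3) n by simp
    ultimately have "r \<odot>\<^bsub>M\<^esub> y \<in> N +>\<^bsub>M\<^esub> (r \<odot>\<^bsub>M\<^esub> x)" by (auto simp: a_r_coset_def')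
    then show ?thesis using N.a_repr_independence' M.smult_closed[OF assms(3,4)] by blast
  qed
  moreover have "x \<in> N +>\<^bsub>M\<^esub> x" using N.a_rcos_self assms by blast
  ultimately have "(\<Union>y\<in>N +>\<^bsub>M\<^esub> x. N +>\<^bsub>M\<^esub> (r \<odot>\<^bsub>M\<^esub> y)) = N +>\<^bsub>M\<^esub> (r \<odot>\<^bsub>M\<^esub> x)" by blast
  then show ?thesis by (simp add: quot_module_def)
qed

lemma quot_module_add:
  assumes "module R M" "submodule N R M" "x \<in> carrier M" "y \<in> carrier M"
  shows "(N +>\<^bsub>M\<^esub> x) \<oplus>\<^bsub>quot_module M N\<^esub> (N +>\<^bsub>M\<^esub> y) = N +>\<^bsub>M\<^esub> (x \<oplus>\<^bsub>M\<^esub> y)"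
  using abelian_subgroup.a_rcos_sum[OF submodule_abelian_subgroup[OF assms(1,2)]] assms(3,4)
  by (simp add: quot_module_def)

lemma quot_module_carrier: "carrier (quot_module M N) = (\<lambda>x. N +>\<^bsub>M\<^esub> x) ` carrier M"
  by (auto simp: quot_module_def A_RCOSETS_def' a_r_coset_def')

lemma quot_module_zero: "\<zero>\<^bsub>quot_module M N\<^esub> = N"
  by (simp add: quot_module_def)

lemma quot_module_module:
  assumes "module R M" "submodule N R M"
  shows "module R (quot_module M N)"
proof -
  interpret M: module R M by fact
  interpret N: abelian_subgroup N M by (rule submodule_abelian_subgroup[OF assms(1,2)])
  have N0: "N = N +>\<^bsub>M\<^esub> \<zero>\<^bsub>M\<^esub>" using M.a_coset_add_zero N.a_subset by simp
  have "\<exists>D\<in>carrier (quot_module M N). D \<oplus>\<^bsub>quot_module M N\<^esub> C = \<zero>\<^bsub>quot_module M N\<^esub>"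
    if C: "C \<in> carrier (quot_module M N)" for C
  proof -
    obtain x where x: "x \<in> carrier M" "C = N +>\<^bsub>M\<^esub> x" using C by (auto simp: quot_module_carrier)
    show ?thesis
      by (rule bexI[of _ "N +>\<^bsub>M\<^esub> (\<ominus>\<^bsub>M\<^esub> x)"])
         (use x N0 in \<open>auto simp: quot_module_add[OF assms] quot_module_zero quot_module_carrier M.l_neg\<close>)
  qed
  moreover have "\<zero>\<^bsub>quot_module M N\<^esub> \<oplus>\<^bsub>quot_module M N\<^esub> C = C"
    if C: "C \<in> carrier (quot_module M N)" for C
  proof -
    obtain x where x: "x \<in> carrier M" "C = N +>\<^bsub>M\<^esub> x" using C by (auto simp: quot_module_carrier)
    have "(N +>\<^bsub>M\<^esub> \<zero>\<^bsub>M\<^esub>) \<oplus>\<^bsub>quot_module M N\<^esub> (N +>\<^bsub>M\<^esub> x) = N +>\<^bsub>M\<^esub> x"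
      using x(1) by (simp add: quot_module_add[OF assms] del: M.a_coset_add_zero)
    then show ?thesis using x N0 by (simp add: quot_module_zero)
  qed
  moreover have "\<zero>\<^bsub>quot_module M N\<^esub> \<in> carrier (quot_module M N)"
    using N0 by (auto simp: quot_module_zero quot_module_carrier)
  ultimately have ag: "abelian_group (quot_module M N)"
    by (intro abelian_groupI) (auto simp: quot_module_carrier quot_module_add[OF assms] M.a_ac)
  show ?thesis
    by (rule moduleI)
       (use ag M.is_cring in \<open>auto simp: quot_module_carrier quot_module_smult[OF assms] quot_module_add[OF assms]
          M.smult_l_distr M.smult_r_distr M.smult_assoc1\<close>)
qed

lemma quot_module_proj:
  assumes "module R M" "submodule N R M"
  shows "(\<lambda>x. N +>\<^bsub>M\<^esub> x) \<in> lin_hom R M (quot_module M N)"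
  by (rule lin_homI) (auto simp: quot_module_carrier quot_module_smult[OF assms] quot_module_add[OF assms])

lemma quot_module_proj_zero:
  assumes "module R M" "submodule N R M" "x \<in> N"
  shows "N +>\<^bsub>M\<^esub> x = \<zero>\<^bsub>quot_module M N\<^esub>"
  using abelian_subgroup.a_rcos_const[OF submodule_abelian_subgroup[OF assms(1,2)] assms(3)]
  by (simp add: quot_module_zero)

lemma quot_module_lift:
  assumes "module R M" "submodule N R M" "module R P" "h \<in> lin_hom R M P"
    and van: "\<And>x. x \<in> N \<Longrightarrow> h x = \<zero>\<^bsub>P\<^esub>"
  obtains g where "g \<in> lin_hom R (quot_module M N) P" "\<And>x. x \<in> carrier M \<Longrightarrow> g (N +>\<^bsub>M\<^esub> x) = h x"
proof -
  interpret M: module R M by fact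
  interpret P: module R P by fact
  interpret N: abelian_subgroup N M by (rule submodule_abelian_subgroup[OF assms(1,2)])
  define g where "g C = h (SOME x. x \<in> C)" for C
  have g: "g (N +>\<^bsub>M\<^esub> x) = h x" if x: "x \<in> carrier M" for x
  proof -
    have "(SOME y. y \<in> N +>\<^bsub>M\<^esub> x) \<in> N +>\<^bsub>M\<^esub> x"
      using N.a_rcos_self[OF x] by (rule someI)
    then obtain n where n: "n \<in> N" "(SOME y. y \<in> N +>\<^bsub>M\<^esub> x) = n \<oplus>\<^bsub>M\<^esub> x"
      by (auto simp: a_r_coset_def')
    then show ?thesis
      using x van lin_hom_closed[OF assms(4) x] by (simp add: g_def lin_hom_add[OF assms(4)])
  qed
  have "g \<in> lin_hom R (quot_module M N) P"
    by (rule lin_homI)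
       (auto simp: quot_module_carrier quot_module_smult[OF assms(1,2)] quot_module_add[OF assms(1,2)] g
          lin_hom_add[OF assms(4)] lin_hom_smult[OF assms(4)] lin_hom_closed[OF assms(4)])
  with g show thesis using that by blast
qed

lemma free_module_module:
  fixes R :: "('k, 'c) ring_scheme" and X :: "'x set"
  assumes "cring R"
  shows "module R (free_module R X)"
proof -
  interpret R: cring R by fact
  have fin_add: "finite {x. f x \<oplus>\<^bsub>R\<^esub> g x \<noteq> \<zero>\<^bsub>R\<^esub>}"
    if "finite {x. f x \<noteq> \<zero>\<^bsub>R\<^esub>}" "finite {x. g x \<noteq> \<zero>\<^bsub>R\<^esub>}" for f g :: "'x \<Rightarrow> 'k"
    by (rule finite_subset[OF _ finite_UnI[OF that]]) auto
  have fin_smult: "finite {x. r \<otimes>\<^bsub>R\<^esub> f x \<noteq> \<zero>\<^bsub>R\<^esub>}"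
    if "finite {x. f x \<noteq> \<zero>\<^bsub>R\<^esub>}" "r \<in> carrier R" for f :: "'x \<Rightarrow> 'k" and r
    by (rule finite_subset[OF _ that(1)]) (use that(2) in auto)
  have inv: "\<exists>g\<in>carrier (free_module R X). g \<oplus>\<^bsub>free_module R X\<^esub> f = \<zero>\<^bsub>free_module R X\<^esub>"
    if "f \<in> carrier (free_module R X)" for f
  proof (rule bexI)
    have "finite {x. \<ominus>\<^bsub>R\<^esub> f x \<noteq> \<zero>\<^bsub>R\<^esub>}"
      by (rule finite_subset[of _ "{x. f x \<noteq> \<zero>\<^bsub>R\<^esub>}"]) (use that in \<open>auto simp: free_module_def\<close>)
    then show "(\<lambda>x. \<ominus>\<^bsub>R\<^esub> f x) \<in> carrier (free_module R X)"
      using that by (auto simp: free_module_def)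
    show "(\<lambda>x. \<ominus>\<^bsub>R\<^esub> f x) \<oplus>\<^bsub>free_module R X\<^esub> f = \<zero>\<^bsub>free_module R X\<^esub>"
      using that by (auto simp: free_module_def R.l_neg)
  qed
  have "abelian_group (free_module R X)"
    by (rule abelian_groupI, rule_tac [6] inv)
       (auto simp: free_module_def R.a_ac intro: fin_add)
  then show ?thesis
    by (intro moduleI assms) (auto simp: free_module_def fin_smult R.l_distr R.r_distr R.m_assoc)
qed

lemma free_gen_closed:
  assumes "cring R" "x \<in> X"
  shows "free_gen R x \<in> carrier (free_module R X)"
proof -
  interpret R: cring R by fact
  have "finite {y. free_gen R x y \<noteq> \<zero>\<^bsub>R\<^esub>}"
    by (rule finite_subset[of _ "{x}"]) (auto simp: free_gen_def)
  then show ?thesis using assms(2) by (auto simp: free_module_def free_gen_def)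
qed

lemma free_module_induct:
  assumes "cring R" "submodule N R (free_module R X)" "\<And>x. x \<in> X \<Longrightarrow> free_gen R x \<in> N"
  shows "carrier (free_module R X) \<subseteq> N"
proof -
  interpret R: cring R by fact
  interpret F: module R "free_module R X" by (rule free_module_module[OF assms(1)])
  have "f \<in> N" if "finite A" "f \<in> carrier (free_module R X)" "{x. f x \<noteq> \<zero>\<^bsub>R\<^esub>} \<subseteq> A" for A f
    using that
  proof (induction A arbitrary: f rule: finite_induct)
    case empty
    then have "f = \<zero>\<^bsub>free_module R X\<^esub>" by (auto simp: free_module_def)
    then show ?case using F.submoduleE(2)[OF assms(2)] subgroup.one_closed[OF submodule.axioms(1)[OF assms(2)]] by simp
  next
    case (insert a A)
    define g where "g = f(a := \<zero>\<^bsub>R\<^esub>)"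
    have g: "g \<in> carrier (free_module R X)"
    proof -
      have "finite {x. g x \<noteq> \<zero>\<^bsub>R\<^esub>}"
        by (rule finite_subset[of _ "{x. f x \<noteq> \<zero>\<^bsub>R\<^esub>}"]) (use insert in \<open>auto simp: g_def free_module_def\<close>)
      then show ?thesis using insert by (auto simp: free_module_def g_def)
    qed
    have gN: "g \<in> N" using insert.prems(2) by (intro insert.IH[OF g]) (auto simp: g_def)
    show ?case
    proof (cases "a \<in> X")
      case True
      have "f = f a \<odot>\<^bsub>free_module R X\<^esub> free_gen R a \<oplus>\<^bsub>free_module R X\<^esub> g"
        using insert.prems(1) by (auto simp: free_module_def free_gen_def g_def)
      moreover have "f a \<in> carrier R" using insert.prems(1) by (simp add: free_module_def)
      ultimately show ?thesis
        using F.submoduleE(4,5)[OF assms(2)] gN assms(3)[OF True] by metis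
    next
      case False
      then have "f = g" using insert.prems(1) by (auto simp: free_module_def g_def)
      then show ?thesis using gN by simp
    qed
  qed
  then show ?thesis by (auto simp: free_module_def)
qed

lemma free_module_lift:
  assumes "cring R" "module R P" "\<And>x. x \<in> X \<Longrightarrow> b x \<in> carrier P"
  obtains h where "h \<in> lin_hom R (free_module R X) P" "\<And>x. x \<in> X \<Longrightarrow> h (free_gen R x) = b x"
proof -
  interpret R: cring R by fact
  interpret P: module R P by fact
  interpret F: module R "free_module R X" by (rule free_module_module[OF assms(1)])
  define h where "h f = (\<Oplus>\<^bsub>P\<^esub>x\<in>{x. f x \<noteq> \<zero>\<^bsub>R\<^esub>}. f x \<odot>\<^bsub>P\<^esub> b x)" for f
  let ?F = "free_module R X"
  have cl: "f x \<odot>\<^bsub>P\<^esub> b x \<in> carrier P" if "f \<in> carrier ?F" "x \<in> X" for f x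
    using that assms(3) by (simp add: free_module_def)
  have supp: "{x. f x \<noteq> \<zero>\<^bsub>R\<^esub>} \<subseteq> X" "finite {x. f x \<noteq> \<zero>\<^bsub>R\<^esub>}" if "f \<in> carrier ?F" for f
    using that by (auto simp: free_module_def)
  have heq: "h f = (\<Oplus>\<^bsub>P\<^esub>x\<in>A. f x \<odot>\<^bsub>P\<^esub> b x)"
    if "f \<in> carrier ?F" "finite A" "{x. f x \<noteq> \<zero>\<^bsub>R\<^esub>} \<subseteq> A" "A \<subseteq> X" for f A
    unfolding h_def
    by (rule P.add.finprod_mono_neutral_cong_left) (use that cl assms(3) in auto)
  have "h \<in> lin_hom R ?F P"
  proof (rule lin_homI)
    fix f assume f: "f \<in> carrier ?F"
    show "h f \<in> carrier P" unfolding h_def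
      by (rule P.finsum_closed) (use f cl supp in blast)
    fix r assume r: "r \<in> carrier R"
    have rf: "r \<odot>\<^bsub>?F\<^esub> f \<in> carrier ?F" using r f by simp
    have "h (r \<odot>\<^bsub>?F\<^esub> f) = (\<Oplus>\<^bsub>P\<^esub>x\<in>{x. f x \<noteq> \<zero>\<^bsub>R\<^esub>}. (r \<odot>\<^bsub>?F\<^esub> f) x \<odot>\<^bsub>P\<^esub> b x)"
      by (rule heq[OF rf]) (use supp[OF f] r in \<open>auto simp: free_module_def\<close>)
    also have "\<dots> = (\<Oplus>\<^bsub>P\<^esub>x\<in>{x. f x \<noteq> \<zero>\<^bsub>R\<^esub>}. r \<odot>\<^bsub>P\<^esub> (f x \<odot>\<^bsub>P\<^esub> b x))"
    proof (rule P.finsum_cong')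
      show "(\<lambda>x. r \<odot>\<^bsub>P\<^esub> (f x \<odot>\<^bsub>P\<^esub> b x)) \<in> {x. f x \<noteq> \<zero>\<^bsub>R\<^esub>} \<rightarrow> carrier P"
        using supp(1)[OF f] cl[OF f] r by blast
      fix x assume "x \<in> {x. f x \<noteq> \<zero>\<^bsub>R\<^esub>}"
      then have "x \<in> X" "f x \<in> carrier R" using supp(1)[OF f] f by (auto simp: free_module_def)
      then show "(r \<odot>\<^bsub>?F\<^esub> f) x \<odot>\<^bsub>P\<^esub> b x = r \<odot>\<^bsub>P\<^esub> (f x \<odot>\<^bsub>P\<^esub> b x)"
        using r assms(3) by (simp add: free_module_def P.smult_assoc1)
    qed simp
    also have "\<dots> = r \<odot>\<^bsub>P\<^esub> h f" unfolding h_def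
      by (rule P.finsum_smult_ldistr[symmetric]) (use supp[OF f] cl[OF f] r in auto)
    finally show "h (r \<odot>\<^bsub>?F\<^esub> f) = r \<odot>\<^bsub>P\<^esub> h f" .
  next
    fix f g assume f: "f \<in> carrier ?F" and g: "g \<in> carrier ?F"
    let ?A = "{x. f x \<noteq> \<zero>\<^bsub>R\<^esub>} \<union> {x. g x \<noteq> \<zero>\<^bsub>R\<^esub>}"
    have A: "finite ?A" "?A \<subseteq> X" using supp f g by auto
    have fg: "f \<oplus>\<^bsub>?F\<^esub> g \<in> carrier ?F" using f g by simp
    have "h (f \<oplus>\<^bsub>?F\<^esub> g) = (\<Oplus>\<^bsub>P\<^esub>x\<in>?A. (f \<oplus>\<^bsub>?F\<^esub> g) x \<odot>\<^bsub>P\<^esub> b x)"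
      by (rule heq[OF fg A(1) _ A(2)]) (auto simp: free_module_def)
    also have "\<dots> = (\<Oplus>\<^bsub>P\<^esub>x\<in>?A. f x \<odot>\<^bsub>P\<^esub> b x \<oplus>\<^bsub>P\<^esub> g x \<odot>\<^bsub>P\<^esub> b x)"
    proof (rule P.finsum_cong')
      show "(\<lambda>x. f x \<odot>\<^bsub>P\<^esub> b x \<oplus>\<^bsub>P\<^esub> g x \<odot>\<^bsub>P\<^esub> b x) \<in> ?A \<rightarrow> carrier P"
        using A(2) cl[OF f] cl[OF g] by blast
      fix x assume "x \<in> ?A"
      then have "x \<in> X" using A(2) by blast
      moreover have "f x \<in> carrier R" "g x \<in> carrier R" using f g by (auto simp: free_module_def)
      ultimately show "(f \<oplus>\<^bsub>?F\<^esub> g) x \<odot>\<^bsub>P\<^esub> b x = f x \<odot>\<^bsub>P\<^esub> b x \<oplus>\<^bsub>P\<^esub> g x \<odot>\<^bsub>P\<^esub> b x"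
        using assms(3) by (simp add: free_module_def P.smult_l_distr)
    qed simp
    also have "\<dots> = (\<Oplus>\<^bsub>P\<^esub>x\<in>?A. f x \<odot>\<^bsub>P\<^esub> b x) \<oplus>\<^bsub>P\<^esub> (\<Oplus>\<^bsub>P\<^esub>x\<in>?A. g x \<odot>\<^bsub>P\<^esub> b x)"
      by (rule P.finsum_addf) (use A(2) cl[OF f] cl[OF g] in blast)+
    also have "\<dots> = h f \<oplus>\<^bsub>P\<^esub> h g"
      using heq[OF f A(1) _ A(2)] heq[OF g A(1) _ A(2)] by simp
    finally show "h (f \<oplus>\<^bsub>?F\<^esub> g) = h f \<oplus>\<^bsub>P\<^esub> h g" .
  qed
  moreover have "h (free_gen R x) = b x" if x: "x \<in> X" for x
  proof -
    have "h (free_gen R x) = (\<Oplus>\<^bsub>P\<^esub>y\<in>{x}. free_gen R x y \<odot>\<^bsub>P\<^esub> b y)"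
      by (rule heq[OF free_gen_closed[OF assms(1) x]]) (use x in \<open>auto simp: free_gen_def\<close>)
    then show ?thesis using assms(3)[OF x] by (simp add: free_gen_def)
  qed
  ultimately show thesis using that by blast
qed

lemma lin_hom_eq_on_submodule:
  assumes "module R M" "module R N" "h \<in> lin_hom R M N" "g \<in> lin_hom R M N"
  shows "submodule {x \<in> carrier M. h x = g x} R M"
proof -
  interpret M: module R M by fact
  interpret N: module R N by fact
  interpret h: abelian_group_hom M N h by (rule lin_hom_abelian_group_hom[OF assms(1-3)])
  interpret g: abelian_group_hom M N g by (rule lin_hom_abelian_group_hom[OF assms(1,2,4)])
  show ?thesis
    by (rule M.submoduleI) (auto simp: lin_hom_smult[OF assms(3)] lin_hom_smult[OF assms(4)])
qed

lemma (in abelian_group) minus_eq_zero_iff: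
  "\<lbrakk>x \<in> carrier G; y \<in> carrier G\<rbrakk> \<Longrightarrow> x \<ominus> y = \<zero> \<longleftrightarrow> x = y"
  by (metis add.inv_closed add.inv_equality minus_eq minus_minus r_neg)

lemma tensor_rels_subset:
  assumes "module R M" "module R N"
  shows "tensor_rels R M N \<subseteq> carrier (free_module R (carrier M \<times> carrier N))"
proof -
  interpret M: module R M by fact
  interpret N: module R N by fact
  interpret F: module R "free_module R (carrier M \<times> carrier N)"
    by (rule free_module_module[OF M.is_cring])
  have e: "free_gen R (x, y) \<in> carrier (free_module R (carrier M \<times> carrier N))"
    if "x \<in> carrier M" "y \<in> carrier N" for x y
    using that by (intro free_gen_closed[OF M.is_cring]) auto
  show ?thesis unfolding tensor_rels_def Let_def
    by (intro Un_least subsetI; elim CollectE exE conjE; hypsubst;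
        intro F.minus_closed F.add.m_closed F.smult_closed e; simp)
qed

lemma tensor_submod_submodule:
  assumes "module R M" "module R N"
  shows "submodule (tensor_submod R M N) R (free_module R (carrier M \<times> carrier N))"
  unfolding tensor_submod_def
  by (intro submodule_submod_gen free_module_module tensor_rels_subset assms module.axioms(1)[OF assms(1)])

lemma tensor_prod_module:
  assumes "module R M" "module R N"
  shows "module R (tensor_prod R M N)"
  unfolding tensor_prod_def
  by (intro quot_module_module free_module_module tensor_submod_submodule assms module.axioms(1)[OF assms(1)])

lemma tensor_closed:
  assumes "module R M" "module R N" "x \<in> carrier M" "y \<in> carrier N"
  shows "tensor R M N x y \<in> carrier (tensor_prod R M N)"
  using assms unfolding tensor_prod_def tensor_def
  by (auto simp: quot_module_carrier intro!: imageI free_gen_closed module.axioms(1))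

lemma tensor_bilinear:
  fixes R :: "('k, 'c) ring_scheme" and M :: "('k, 'a, 'd) module_scheme" and N :: "('k, 'b, 'e) module_scheme"
  assumes mods: "module R M" "module R N"
  shows "\<lbrakk>x \<in> carrier M; x' \<in> carrier M; y \<in> carrier N\<rbrakk> \<Longrightarrow>
      tensor R M N (x \<oplus>\<^bsub>M\<^esub> x') y = tensor R M N x y \<oplus>\<^bsub>tensor_prod R M N\<^esub> tensor R M N x' y"
    and "\<lbrakk>x \<in> carrier M; y \<in> carrier N; y' \<in> carrier N\<rbrakk> \<Longrightarrow>
      tensor R M N x (y \<oplus>\<^bsub>N\<^esub> y') = tensor R M N x y \<oplus>\<^bsub>tensor_prod R M N\<^esub> tensor R M N x y'"
    and "\<lbrakk>r \<in> carrier R; x \<in> carrier M; y \<in> carrier N\<rbrakk> \<Longrightarrow>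
      tensor R M N (r \<odot>\<^bsub>M\<^esub> x) y = r \<odot>\<^bsub>tensor_prod R M N\<^esub> tensor R M N x y"
    and "\<lbrakk>r \<in> carrier R; x \<in> carrier M; y \<in> carrier N\<rbrakk> \<Longrightarrow>
      tensor R M N x (r \<odot>\<^bsub>N\<^esub> y) = r \<odot>\<^bsub>tensor_prod R M N\<^esub> tensor R M N x y"
proof -
  interpret M: module R M by fact
  interpret N: module R N by fact
  let ?F = "free_module R (carrier M \<times> carrier N)"
  interpret F: module R ?F by (rule free_module_module[OF M.is_cring])
  interpret T: module R "tensor_prod R M N" by (rule tensor_prod_module[OF mods])
  define p where "p = (\<lambda>f. tensor_submod R M N +>\<^bsub>?F\<^esub> f)"
  have p: "p \<in> lin_hom R ?F (tensor_prod R M N)" unfolding p_def tensor_prod_def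
    by (rule quot_module_proj[OF F.module_axioms tensor_submod_submodule[OF mods]])
  have t: "tensor R M N x y = p (free_gen R (x, y))" for x y
    by (simp add: tensor_def p_def)
  have e[simp]: "free_gen R (x, y) \<in> carrier ?F"
    if "x \<in> carrier M" "y \<in> carrier N" for x y
    using that by (intro free_gen_closed[OF M.is_cring]) auto
  have eq: "p f = p g" if "f \<ominus>\<^bsub>?F\<^esub> g \<in> tensor_rels R M N" "f \<in> carrier ?F" "g \<in> carrier ?F" for f g
  proof -
    have "f \<ominus>\<^bsub>?F\<^esub> g \<in> tensor_submod R M N"
      using that(1) unfolding tensor_submod_def by (rule subsetD[OF submod_gen_incl])
    then have "p (f \<ominus>\<^bsub>?F\<^esub> g) = \<zero>\<^bsub>tensor_prod R M N\<^esub>"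
      unfolding p_def tensor_prod_def
      by (rule quot_module_proj_zero[OF F.module_axioms tensor_submod_submodule[OF mods]])
    then show ?thesis
      using lin_hom_minus[OF F.module_axioms T.module_axioms p that(2,3)] lin_hom_closed[OF p] that(2,3)
      by (simp add: T.minus_eq_zero_iff)
  qed
  note psimps = lin_hom_add[OF p] lin_hom_smult[OF p]
  { assume *: "x \<in> carrier M" "x' \<in> carrier M" "y \<in> carrier N"
    have "p (free_gen R (x \<oplus>\<^bsub>M\<^esub> x', y)) = p (free_gen R (x, y) \<oplus>\<^bsub>?F\<^esub> free_gen R (x', y))"
    proof (rule eq)
      show "free_gen R (x \<oplus>\<^bsub>M\<^esub> x', y) \<ominus>\<^bsub>?F\<^esub> (free_gen R (x, y) \<oplus>\<^bsub>?F\<^esub> free_gen R (x', y)) \<in> tensor_rels R M N"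
        unfolding tensor_rels_def Let_def using * by (intro UnI1) blast
    qed (use * in simp_all)
    then show "tensor R M N (x \<oplus>\<^bsub>M\<^esub> x') y = tensor R M N x y \<oplus>\<^bsub>tensor_prod R M N\<^esub> tensor R M N x' y"
      using * by (simp add: t psimps) }
  { assume *: "x \<in> carrier M" "y \<in> carrier N" "y' \<in> carrier N"
    have "p (free_gen R (x, y \<oplus>\<^bsub>N\<^esub> y')) = p (free_gen R (x, y) \<oplus>\<^bsub>?F\<^esub> free_gen R (x, y'))"
      by (rule eq) (use * in \<open>auto simp: tensor_rels_def Let_def\<close>)
    then show "tensor R M N x (y \<oplus>\<^bsub>N\<^esub> y') = tensor R M N x y \<oplus>\<^bsub>tensor_prod R M N\<^esub> tensor R M N x y'"
      using * by (simp add: t psimps) }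
  { assume *: "r \<in> carrier R" "x \<in> carrier M" "y \<in> carrier N"
    have "p (free_gen R (r \<odot>\<^bsub>M\<^esub> x, y)) = p (r \<odot>\<^bsub>?F\<^esub> free_gen R (x, y))"
      by (rule eq) (use * in \<open>auto simp: tensor_rels_def Let_def\<close>)
    then show "tensor R M N (r \<odot>\<^bsub>M\<^esub> x) y = r \<odot>\<^bsub>tensor_prod R M N\<^esub> tensor R M N x y"
      using * by (simp add: t psimps) }
  { assume *: "r \<in> carrier R" "x \<in> carrier M" "y \<in> carrier N"
    have "p (free_gen R (x, r \<odot>\<^bsub>N\<^esub> y)) = p (r \<odot>\<^bsub>?F\<^esub> free_gen R (x, y))"
      by (rule eq) (use * in \<open>auto simp: tensor_rels_def Let_def\<close>)
    then show "tensor R M N x (r \<odot>\<^bsub>N\<^esub> y) = r \<odot>\<^bsub>tensor_prod R M N\<^esub> tensor R M N x y"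
      using * by (simp add: t psimps) }
qed

lemma tensor_lift:
  assumes mods: "module R M" "module R N" "module R P"
    and cl: "\<And>x y. \<lbrakk>x \<in> carrier M; y \<in> carrier N\<rbrakk> \<Longrightarrow> b x y \<in> carrier P"
    and add_l: "\<And>x x' y. \<lbrakk>x \<in> carrier M; x' \<in> carrier M; y \<in> carrier N\<rbrakk> \<Longrightarrow>
      b (x \<oplus>\<^bsub>M\<^esub> x') y = b x y \<oplus>\<^bsub>P\<^esub> b x' y"
    and add_r: "\<And>x y y'. \<lbrakk>x \<in> carrier M; y \<in> carrier N; y' \<in> carrier N\<rbrakk> \<Longrightarrow>
      b x (y \<oplus>\<^bsub>N\<^esub> y') = b x y \<oplus>\<^bsub>P\<^esub> b x y'"
    and smult_l: "\<And>r x y. \<lbrakk>r \<in> carrier R; x \<in> carrier M; y \<in> carrier N\<rbrakk> \<Longrightarrow>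
      b (r \<odot>\<^bsub>M\<^esub> x) y = r \<odot>\<^bsub>P\<^esub> b x y"
    and smult_r: "\<And>r x y. \<lbrakk>r \<in> carrier R; x \<in> carrier M; y \<in> carrier N\<rbrakk> \<Longrightarrow>
      b x (r \<odot>\<^bsub>N\<^esub> y) = r \<odot>\<^bsub>P\<^esub> b x y"
  obtains h where "h \<in> lin_hom R (tensor_prod R M N) P"
    "\<And>x y. \<lbrakk>x \<in> carrier M; y \<in> carrier N\<rbrakk> \<Longrightarrow> h (tensor R M N x y) = b x y"
proof -
  interpret M: module R M by fact
  interpret N: module R N by fact
  interpret P: module R P by fact
  let ?F = "free_module R (carrier M \<times> carrier N)"
  interpret F: module R ?F by (rule free_module_module[OF M.is_cring])
  have e[simp]: "free_gen R (x, y) \<in> carrier ?F"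
    if "x \<in> carrier M" "y \<in> carrier N" for x y
    using that by (intro free_gen_closed[OF M.is_cring]) auto
  obtain k where k: "k \<in> lin_hom R ?F P"
    and kb: "\<And>z. z \<in> carrier M \<times> carrier N \<Longrightarrow> k (free_gen R z) = (\<lambda>(x, y). b x y) z"
    by (rule free_module_lift[OF M.is_cring mods(3), of "carrier M \<times> carrier N" "\<lambda>(x, y). b x y"])
       (auto simp: cl)
  have kb'[simp]: "k (free_gen R (x, y)) = b x y" if "x \<in> carrier M" "y \<in> carrier N" for x y
    using kb that by auto
  note ks = lin_hom_minus[OF F.module_axioms mods(3) k] lin_hom_add[OF k] lin_hom_smult[OF k]
  have "k z = \<zero>\<^bsub>P\<^esub>" if "z \<in> tensor_rels R M N" for z
    using that unfolding tensor_rels_def Let_def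
    by (elim UnE CollectE exE conjE) (simp_all add: ks cl add_l add_r smult_l smult_r P.minus_eq_zero_iff)
  then have "k z = \<zero>\<^bsub>P\<^esub>" if "z \<in> tensor_submod R M N" for z
    using that lin_hom_vanish_submod_gen[OF F.module_axioms mods(3) k tensor_rels_subset[OF mods(1,2)]]
    unfolding tensor_submod_def by blast
  then obtain h where "h \<in> lin_hom R (tensor_prod R M N) P"
    "\<And>z. z \<in> carrier ?F \<Longrightarrow> h (tensor_submod R M N +>\<^bsub>?F\<^esub> z) = k z"
    using quot_module_lift[OF F.module_axioms tensor_submod_submodule[OF mods(1,2)] mods(3) k]
    unfolding tensor_prod_def by blast
  then show thesis by (intro that[of h]) (simp_all add: tensor_def)
qed

lemma tensor_induct:
  assumes mods: "module R M" "module R N"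
    and K: "submodule K R (tensor_prod R M N)"
    and gen: "\<And>x y. \<lbrakk>x \<in> carrier M; y \<in> carrier N\<rbrakk> \<Longrightarrow> tensor R M N x y \<in> K"
  shows "carrier (tensor_prod R M N) \<subseteq> K"
proof -
  interpret M: module R M by fact
  let ?F = "free_module R (carrier M \<times> carrier N)"
  interpret F: module R ?F by (rule free_module_module[OF M.is_cring])
  interpret T: module R "tensor_prod R M N" by (rule tensor_prod_module[OF mods])
  define p where "p = (\<lambda>f. tensor_submod R M N +>\<^bsub>?F\<^esub> f)"
  have p: "p \<in> lin_hom R ?F (tensor_prod R M N)" unfolding p_def tensor_prod_def
    by (rule quot_module_proj[OF F.module_axioms tensor_submod_submodule[OF mods]])
  interpret p: abelian_group_hom ?F "tensor_prod R M N" p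
    by (rule lin_hom_abelian_group_hom[OF F.module_axioms T.module_axioms p])
  have "\<zero>\<^bsub>tensor_prod R M N\<^esub> \<in> K" using subgroup.one_closed[OF submodule.axioms(1)[OF K]] by simp
  then have "submodule {f \<in> carrier ?F. p f \<in> K} R ?F"
    by (intro F.submoduleI) (auto simp: lin_hom_smult[OF p] T.submoduleE(3-5)[OF K])
  moreover have "free_gen R z \<in> {f \<in> carrier ?F. p f \<in> K}" if "z \<in> carrier M \<times> carrier N" for z
    using that gen free_gen_closed[OF M.is_cring that] by (auto simp: tensor_def p_def)
  ultimately have "carrier ?F \<subseteq> {f \<in> carrier ?F. p f \<in> K}"
    by (rule free_module_induct[OF M.is_cring])
  then show ?thesis by (auto simp: tensor_prod_def quot_module_carrier p_def)
qed

lemma ext_submod_submodule: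
  assumes "module R M"
  shows "submodule (ext_submod R M) R (tensor_prod R M M)"
  unfolding ext_submod_def
  by (rule submodule_submod_gen) (auto intro!: tensor_prod_module tensor_closed assms)

lemma ext_square_module:
  assumes "module R M"
  shows "module R (ext_square R M)"
  unfolding ext_square_def
  by (intro quot_module_module tensor_prod_module ext_submod_submodule assms)

lemma ext_proj:
  assumes "module R M"
  shows "(\<lambda>t. ext_submod R M +>\<^bsub>tensor_prod R M M\<^esub> t) \<in> lin_hom R (tensor_prod R M M) (ext_square R M)"
  unfolding ext_square_def
  by (intro quot_module_proj tensor_prod_module ext_submod_submodule assms)

lemma wedge_closed:
  assumes "module R M" "x \<in> carrier M" "y \<in> carrier M"
  shows "wedge R M x y \<in> carrier (ext_square R M)"
  unfolding wedge_def by (rule lin_hom_closed[OF ext_proj[OF assms(1)] tensor_closed[OF assms(1,1,2,3)]])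

lemma wedge_bilinear:
  assumes "module R M"
  shows "\<lbrakk>x \<in> carrier M; x' \<in> carrier M; y \<in> carrier M\<rbrakk> \<Longrightarrow>
      wedge R M (x \<oplus>\<^bsub>M\<^esub> x') y = wedge R M x y \<oplus>\<^bsub>ext_square R M\<^esub> wedge R M x' y"
    and "\<lbrakk>x \<in> carrier M; y \<in> carrier M; y' \<in> carrier M\<rbrakk> \<Longrightarrow>
      wedge R M x (y \<oplus>\<^bsub>M\<^esub> y') = wedge R M x y \<oplus>\<^bsub>ext_square R M\<^esub> wedge R M x y'"
    and "\<lbrakk>r \<in> carrier R; x \<in> carrier M; y \<in> carrier M\<rbrakk> \<Longrightarrow>
      wedge R M (r \<odot>\<^bsub>M\<^esub> x) y = r \<odot>\<^bsub>ext_square R M\<^esub> wedge R M x y"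
    and "\<lbrakk>r \<in> carrier R; x \<in> carrier M; y \<in> carrier M\<rbrakk> \<Longrightarrow>
      wedge R M x (r \<odot>\<^bsub>M\<^esub> y) = r \<odot>\<^bsub>ext_square R M\<^esub> wedge R M x y"
  unfolding wedge_def
  by (simp_all add: tensor_bilinear[OF assms assms] tensor_closed[OF assms assms]
      lin_hom_add[OF ext_proj[OF assms]] lin_hom_smult[OF ext_proj[OF assms]])

lemma wedge_self:
  assumes "module R M" "x \<in> carrier M"
  shows "wedge R M x x = \<zero>\<^bsub>ext_square R M\<^esub>"
proof -
  have "tensor R M M x x \<in> ext_submod R M"
    unfolding ext_submod_def by (rule subsetD[OF submod_gen_incl]) (use assms in auto)
  then show ?thesis unfolding wedge_def ext_square_def
    by (rule quot_module_proj_zero[OF tensor_prod_module[OF assms(1,1)] ext_submod_submodule[OF assms(1)]])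
qed

lemma wedge_lift:
  assumes mods: "module R M" "module R P" and h: "h \<in> lin_hom R (tensor_prod R M M) P"
    and alt: "\<And>x. x \<in> carrier M \<Longrightarrow> h (tensor R M M x x) = \<zero>\<^bsub>P\<^esub>"
  obtains g where "g \<in> lin_hom R (ext_square R M) P"
    "\<And>t. t \<in> carrier (tensor_prod R M M) \<Longrightarrow> g (ext_submod R M +>\<^bsub>tensor_prod R M M\<^esub> t) = h t"
proof -
  have "h z = \<zero>\<^bsub>P\<^esub>" if "z \<in> ext_submod R M" for z
    using that unfolding ext_submod_def
    by (rule lin_hom_vanish_submod_gen[OF tensor_prod_module[OF mods(1,1)] mods(2) h, rotated 2])
       (auto simp: alt tensor_closed mods)
  then show thesis
    using quot_module_lift[OF tensor_prod_module[OF mods(1,1)] ext_submod_submodule[OF mods(1)] mods(2) h] that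
    unfolding ext_square_def by blast
qed

lemma wedge_induct:
  assumes "module R M" and K: "submodule K R (ext_square R M)"
    and gen: "\<And>x y. \<lbrakk>x \<in> carrier M; y \<in> carrier M\<rbrakk> \<Longrightarrow> wedge R M x y \<in> K"
  shows "carrier (ext_square R M) \<subseteq> K"
proof -
  let ?T = "tensor_prod R M M"
  interpret T: module R ?T by (rule tensor_prod_module[OF assms(1,1)])
  interpret E: module R "ext_square R M" by (rule ext_square_module[OF assms(1)])
  define p where "p = (\<lambda>t. ext_submod R M +>\<^bsub>?T\<^esub> t)"
  have p: "p \<in> lin_hom R ?T (ext_square R M)" unfolding p_def by (rule ext_proj[OF assms(1)])
  interpret p: abelian_group_hom ?T "ext_square R M" p
    by (rule lin_hom_abelian_group_hom[OF T.module_axioms E.module_axioms p])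
  have "\<zero>\<^bsub>ext_square R M\<^esub> \<in> K" using subgroup.one_closed[OF submodule.axioms(1)[OF K]] by simp
  then have "submodule {t \<in> carrier ?T. p t \<in> K} R ?T"
    by (intro T.submoduleI) (auto simp: lin_hom_smult[OF p] E.submoduleE(3-5)[OF K])
  moreover have "tensor R M M x y \<in> {t \<in> carrier ?T. p t \<in> K}" if "x \<in> carrier M" "y \<in> carrier M" for x y
    using that gen tensor_closed[OF assms(1,1)] by (auto simp: wedge_def p_def)
  ultimately have "carrier ?T \<subseteq> {t \<in> carrier ?T. p t \<in> K}"
    by (rule tensor_induct[OF assms(1,1)])
  then show ?thesis by (auto simp: ext_square_def quot_module_carrier p_def)
qed

lemma wedge_bdry_unique:
  assumes "module R M"
  shows "\<exists>!D. D \<in> lin_hom R (ext_square R M) (tensor_prod R M M) \<and>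
     D \<in> extensional (carrier (ext_square R M)) \<and>
     (\<forall>a\<in>carrier M. \<forall>b\<in>carrier M.
        D (wedge R M a b) = tensor R M M a b \<ominus>\<^bsub>tensor_prod R M M\<^esub> tensor R M M b a)"
    (is "\<exists>!D. ?P D")
proof -
  let ?T = "tensor_prod R M M" and ?E = "ext_square R M"
  interpret M: module R M by fact
  interpret T: module R ?T by (rule tensor_prod_module[OF assms(1,1)])
  interpret E: module R ?E by (rule ext_square_module[OF assms(1)])
  note tc = tensor_closed[OF assms assms] and tb = tensor_bilinear[OF assms assms]
  obtain h where h: "h \<in> lin_hom R ?T ?T"
    and ht: "\<And>a b. \<lbrakk>a \<in> carrier M; b \<in> carrier M\<rbrakk> \<Longrightarrow>
      h (tensor R M M a b) = tensor R M M a b \<ominus>\<^bsub>?T\<^esub> tensor R M M b a"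
    by (rule tensor_lift[OF assms assms T.module_axioms, of "\<lambda>a b. tensor R M M a b \<ominus>\<^bsub>?T\<^esub> tensor R M M b a"])
       (auto simp: tc tb a_minus_def T.minus_add T.a_ac T.smult_r_distr T.smult_r_minus)
  obtain g where g: "g \<in> lin_hom R ?E ?T"
    and gt: "\<And>t. t \<in> carrier ?T \<Longrightarrow> g (ext_submod R M +>\<^bsub>?T\<^esub> t) = h t"
    by (rule wedge_lift[OF assms T.module_axioms h]) (simp_all add: ht tc T.minus_eq_zero_iff)
  have "?P (restrict g (carrier ?E))"
    using g wedge_closed[OF assms] by (auto simp: lin_hom_def wedge_def gt ht tc)
  moreover have "D = D'" if D: "?P D" and D': "?P D'" for D D'
  proof (rule extensionalityI[of _ "carrier ?E"])
    have "carrier ?E \<subseteq> {x \<in> carrier ?E. D x = D' x}"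
      by (rule wedge_induct[OF assms lin_hom_eq_on_submodule[OF E.module_axioms T.module_axioms]])
         (use D D' wedge_closed[OF assms] in auto)
    then show "\<And>x. x \<in> carrier ?E \<Longrightarrow> D x = D' x" by auto
  qed (use D D' in auto)
  ultimately show ?thesis by blast
qed

lemma wedge_bdry:
  assumes "module R M"
  shows "wedge_bdry R M \<in> lin_hom R (ext_square R M) (tensor_prod R M M)"
    and "\<lbrakk>a \<in> carrier M; b \<in> carrier M\<rbrakk> \<Longrightarrow>
      wedge_bdry R M (wedge R M a b) = tensor R M M a b \<ominus>\<^bsub>tensor_prod R M M\<^esub> tensor R M M b a"
  using theI'[OF wedge_bdry_unique[OF assms]] unfolding wedge_bdry_def by blast+

lemma wedge_lie_lie_algebra:
  assumes "module R M"
  shows "lie_algebra R (wedge_lie R M)"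
proof -
  interpret M: module R M by fact
  interpret E: module R "ext_square R M" by (rule ext_square_module[OF assms(1)])
  let ?L = "wedge_lie R M"
  have "\<exists>y\<in>carrier ?L. y \<oplus>\<^bsub>?L\<^esub> x = \<zero>\<^bsub>?L\<^esub>" if "x \<in> carrier ?L" for x
    by (rule bexI[of _ "(\<ominus>\<^bsub>M\<^esub> fst x, \<ominus>\<^bsub>ext_square R M\<^esub> snd x)"])
       (use that in \<open>auto simp: wedge_lie_def Let_def M.l_neg E.l_neg\<close>)
  then have "abelian_group ?L"
    by (intro abelian_groupI) (auto simp: wedge_lie_def Let_def M.a_ac E.a_ac)
  then have "module R ?L"
    by (intro moduleI M.is_cring)
       (auto simp: wedge_lie_def Let_def M.smult_l_distr E.smult_l_distr M.smult_r_distr E.smult_r_distr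
          M.smult_assoc1 E.smult_assoc1)
  moreover have "wedge R M x \<zero>\<^bsub>M\<^esub> = \<zero>\<^bsub>ext_square R M\<^esub>" if "x \<in> carrier M" for x
    using wedge_bilinear(4)[OF assms M.R.zero_closed that M.zero_closed] that wedge_closed[OF assms] by simp
  ultimately show ?thesis
    by (intro lie_algebra.intro lie_algebra_axioms.intro)
       (auto simp: wedge_lie_def Let_def wedge_closed[OF assms] wedge_bilinear[OF assms] wedge_self[OF assms])
qed

lemma (in abelian_monoid) finsum_Sigma:
  assumes "finite A" "\<And>a. a \<in> A \<Longrightarrow> finite (B a)" "\<And>a b. \<lbrakk>a \<in> A; b \<in> B a\<rbrakk> \<Longrightarrow> f (a, b) \<in> carrier G"
  shows "(\<Oplus>p\<in>Sigma A B. f p) = (\<Oplus>a\<in>A. \<Oplus>b\<in>B a. f (a, b))"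
  using assms
proof (induction A rule: finite_induct)
  case (insert a A)
  have S: "Sigma (insert a A) B = Pair a ` B a \<union> Sigma A B" by auto
  have "(\<Oplus>p\<in>Sigma (insert a A) B. f p) = (\<Oplus>p\<in>Pair a ` B a. f p) \<oplus> (\<Oplus>p\<in>Sigma A B. f p)"
    unfolding S by (rule finsum_Un_disjoint) (use insert in auto)
  also have "(\<Oplus>p\<in>Pair a ` B a. f p) = (\<Oplus>b\<in>B a. f (a, b))"
    by (rule finsum_reindex) (use insert.prems in \<open>auto intro: inj_onI\<close>)
  also have "(\<Oplus>p\<in>Sigma A B. f p) = (\<Oplus>a\<in>A. \<Oplus>b\<in>B a. f (a, b))"
    using insert by simp
  also have "(\<Oplus>b\<in>B a. f (a, b)) \<oplus> \<dots> = (\<Oplus>a\<in>insert a A. \<Oplus>b\<in>B a. f (a, b))"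
    by (rule finsum_insert[symmetric]) (use insert in \<open>auto intro!: finsum_closed\<close>)
  finally show ?case .
qed simp

lemma finite_splits: "finite {p. fst p @ snd p = w}"
proof -
  have "{p. fst p @ snd p = w} \<subseteq> (\<lambda>i. (take i w, drop i w)) ` {..length w}"
  proof
    fix p :: "'a list \<times> 'a list"
    assume "p \<in> {p. fst p @ snd p = w}"
    then have "p = (take (length (fst p)) w, drop (length (fst p)) w)" "length (fst p) \<le> length w"
      by (auto simp: prod_eq_iff)
    then show "p \<in> (\<lambda>i. (take i w, drop i w)) ` {..length w}" by blast
  qed
  then show ?thesis by (rule finite_subset) simp
qed

lemma module_upd:
  assumes "module R M"
  shows "module R (M\<lparr>mult := m, one := e\<rparr>)"
proof -
  interpret M: module R M by fact
  have "abelian_group (M\<lparr>mult := m, one := e\<rparr>)"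
    by (rule abelian_groupI) (auto simp: M.a_ac intro!: bexI[of _ "\<ominus>\<^bsub>M\<^esub> _"] M.l_neg)
  then show ?thesis
    by (intro moduleI M.is_cring) (auto simp: M.smult_l_distr M.smult_r_distr M.smult_assoc1)
qed

lemma free_algebra_module:
  assumes "cring R" shows "module R (free_algebra R X)"
  unfolding free_algebra_def by (rule module_upd[OF free_module_module[OF assms]])

lemma free_algebra_assoc_algebra:
  fixes R :: "('k, 'c) ring_scheme" and X :: "'x set"
  assumes "cring R"
  shows "assoc_algebra R (free_algebra R X)"
proof -
  interpret R: cring R by fact
  let ?A = "free_algebra R X"
  interpret A: module R ?A by (rule free_algebra_module[OF assms])
  have car: "f w \<in> carrier R" "w \<notin> lists X \<Longrightarrow> f w = \<zero>\<^bsub>R\<^esub>" "finite {w. f w \<noteq> \<zero>\<^bsub>R\<^esub>}"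
    if "f \<in> carrier ?A" for f w
    using that by (auto simp: free_algebra_def free_module_def)
  have mult: "(f \<otimes>\<^bsub>?A\<^esub> g) w = (\<Oplus>\<^bsub>R\<^esub>p\<in>{p. fst p @ snd p = w}. f (fst p) \<otimes>\<^bsub>R\<^esub> g (snd p))" for f g w
    by (simp add: free_algebra_def)
  have add: "(f \<oplus>\<^bsub>?A\<^esub> g) w = f w \<oplus>\<^bsub>R\<^esub> g w" for f g w
    by (simp add: free_algebra_def free_module_def)
  have smult: "(r \<odot>\<^bsub>?A\<^esub> f) w = r \<otimes>\<^bsub>R\<^esub> f w" for r f w
    by (simp add: free_algebra_def free_module_def)
  have one: "\<one>\<^bsub>?A\<^esub> = free_gen R []" by (simp add: free_algebra_def)
  have mc: "f \<otimes>\<^bsub>?A\<^esub> g \<in> carrier ?A" if f: "f \<in> carrier ?A" and g: "g \<in> carrier ?A" for f g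
  proof -
    have z: "(f \<otimes>\<^bsub>?A\<^esub> g) w = \<zero>\<^bsub>R\<^esub>" if "\<And>u v. u @ v = w \<Longrightarrow> f u = \<zero>\<^bsub>R\<^esub> \<or> g v = \<zero>\<^bsub>R\<^esub>" for w
    proof -
      have "f u \<otimes>\<^bsub>R\<^esub> g v = \<zero>\<^bsub>R\<^esub>" if "u @ v = w" for u v
        using \<open>\<And>u v. u @ v = w \<Longrightarrow> _\<close>[OF that] car(1)[OF f, of u] car(1)[OF g, of v] by auto
      then show ?thesis unfolding mult by (intro R.add.finprod_one_eqI) auto
    qed
    have "finite {w. (f \<otimes>\<^bsub>?A\<^esub> g) w \<noteq> \<zero>\<^bsub>R\<^esub>}"
    proof (rule finite_subset)
      show "{w. (f \<otimes>\<^bsub>?A\<^esub> g) w \<noteq> \<zero>\<^bsub>R\<^esub>} \<subseteq>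
          (\<lambda>(u, v). u @ v) ` ({w. f w \<noteq> \<zero>\<^bsub>R\<^esub>} \<times> {w. g w \<noteq> \<zero>\<^bsub>R\<^esub>})"
      proof
        fix w assume "w \<in> {w. (f \<otimes>\<^bsub>?A\<^esub> g) w \<noteq> \<zero>\<^bsub>R\<^esub>}"
        then obtain u v where "u @ v = w" "f u \<noteq> \<zero>\<^bsub>R\<^esub>" "g v \<noteq> \<zero>\<^bsub>R\<^esub>" using z[of w] by blast
        then show "w \<in> (\<lambda>(u, v). u @ v) ` ({w. f w \<noteq> \<zero>\<^bsub>R\<^esub>} \<times> {w. g w \<noteq> \<zero>\<^bsub>R\<^esub>})"
          by (intro image_eqI[of _ _ "(u, v)"]) auto
      qed
    qed (use car(3) f g in blast)
    moreover have "(f \<otimes>\<^bsub>?A\<^esub> g) w = \<zero>\<^bsub>R\<^esub>" if "w \<notin> lists X" for w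
    proof (rule z)
      fix u v assume "u @ v = w"
      then have "u \<notin> lists X \<or> v \<notin> lists X" using that by auto
      then show "f u = \<zero>\<^bsub>R\<^esub> \<or> g v = \<zero>\<^bsub>R\<^esub>" using car(2) f g by blast
    qed
    moreover have "(f \<otimes>\<^bsub>?A\<^esub> g) w \<in> carrier R" for w
      unfolding mult by (rule R.finsum_closed) (use car(1) f g in auto)
    ultimately show ?thesis by (auto simp: free_algebra_def free_module_def)
  qed
  have assoc: "f \<otimes>\<^bsub>?A\<^esub> g \<otimes>\<^bsub>?A\<^esub> h = f \<otimes>\<^bsub>?A\<^esub> (g \<otimes>\<^bsub>?A\<^esub> h)"
    if f: "f \<in> carrier ?A" and g: "g \<in> carrier ?A" and h: "h \<in> carrier ?A" for f g h
  proof
    fix w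
    let ?S = "\<lambda>w :: 'x list. {p. fst p @ snd p = w}"
    let ?t = "\<lambda>u v x. f u \<otimes>\<^bsub>R\<^esub> (g v \<otimes>\<^bsub>R\<^esub> h x)"
    have cl[simp]: "f u \<in> carrier R" "g u \<in> carrier R" "h u \<in> carrier R" for u
      using car(1) f g h by auto
    let ?L = "Sigma (?S w) (\<lambda>p. ?S (fst p))" and ?R = "Sigma (?S w) (\<lambda>p. ?S (snd p))"
    have "(f \<otimes>\<^bsub>?A\<^esub> g \<otimes>\<^bsub>?A\<^esub> h) w =
        (\<Oplus>\<^bsub>R\<^esub>p\<in>?S w. (\<Oplus>\<^bsub>R\<^esub>q\<in>?S (fst p). f (fst q) \<otimes>\<^bsub>R\<^esub> g (snd q)) \<otimes>\<^bsub>R\<^esub> h (snd p))"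
      by (simp add: mult)
    also have "\<dots> = (\<Oplus>\<^bsub>R\<^esub>p\<in>?S w. \<Oplus>\<^bsub>R\<^esub>q\<in>?S (fst p). ?t (fst q) (snd q) (snd p))"
      by (rule R.finsum_cong') (auto simp: R.finsum_ldistr finite_splits R.m_assoc intro!: R.finsum_closed)
    also have "\<dots> = (\<Oplus>\<^bsub>R\<^esub>z\<in>?L. ?t (fst (snd z)) (snd (snd z)) (snd (fst z)))"
      by (subst R.finsum_Sigma) (auto simp: finite_splits)
    also have "?L = (\<lambda>((u, y), (v, x)). ((u @ v, x), (u, v))) ` ?R"
      by (force simp: image_iff)
    also have "(\<Oplus>\<^bsub>R\<^esub>z\<in>\<dots>. ?t (fst (snd z)) (snd (snd z)) (snd (fst z))) =
        (\<Oplus>\<^bsub>R\<^esub>z\<in>?R. ?t (fst (fst z)) (fst (snd z)) (snd (snd z)))"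
      by (subst R.finsum_reindex)
         (auto simp: split_def inj_on_def intro!: R.finsum_cong')
    also have "\<dots> = (\<Oplus>\<^bsub>R\<^esub>p\<in>?S w. \<Oplus>\<^bsub>R\<^esub>q\<in>?S (snd p). ?t (fst p) (fst q) (snd q))"
      by (subst R.finsum_Sigma) (auto simp: finite_splits)
    also have "\<dots> = (\<Oplus>\<^bsub>R\<^esub>p\<in>?S w. f (fst p) \<otimes>\<^bsub>R\<^esub> (\<Oplus>\<^bsub>R\<^esub>q\<in>?S (snd p). g (fst q) \<otimes>\<^bsub>R\<^esub> h (snd q)))"
      by (rule R.finsum_cong') (auto simp: R.finsum_rdistr finite_splits intro!: R.finsum_closed)
    also have "\<dots> = (f \<otimes>\<^bsub>?A\<^esub> (g \<otimes>\<^bsub>?A\<^esub> h)) w"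
      by (simp add: mult)
    finally show "(f \<otimes>\<^bsub>?A\<^esub> g \<otimes>\<^bsub>?A\<^esub> h) w = (f \<otimes>\<^bsub>?A\<^esub> (g \<otimes>\<^bsub>?A\<^esub> h)) w" .
  qed
  have onec: "\<one>\<^bsub>?A\<^esub> \<in> carrier ?A"
    using free_gen_closed[OF assms, of "[]" "lists X"] by (simp add: one) (simp add: free_algebra_def)
  have l_one: "\<one>\<^bsub>?A\<^esub> \<otimes>\<^bsub>?A\<^esub> f = f" if f: "f \<in> carrier ?A" for f
  proof
    fix w
    have "(\<one>\<^bsub>?A\<^esub> \<otimes>\<^bsub>?A\<^esub> f) w =
        (\<Oplus>\<^bsub>R\<^esub>p\<in>{([] :: 'x list, w)}. free_gen R [] (fst p) \<otimes>\<^bsub>R\<^esub> f (snd p))"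
      unfolding mult one
      by (rule R.add.finprod_mono_neutral_cong_left[symmetric])
         (auto simp: finite_splits free_gen_def car(1)[OF f])
    then show "(\<one>\<^bsub>?A\<^esub> \<otimes>\<^bsub>?A\<^esub> f) w = f w" using car(1)[OF f] by (simp add: free_gen_def)
  qed
  have r_one: "f \<otimes>\<^bsub>?A\<^esub> \<one>\<^bsub>?A\<^esub> = f" if f: "f \<in> carrier ?A" for f
  proof
    fix w
    have "(f \<otimes>\<^bsub>?A\<^esub> \<one>\<^bsub>?A\<^esub>) w =
        (\<Oplus>\<^bsub>R\<^esub>p\<in>{(w, [] :: 'x list)}. f (fst p) \<otimes>\<^bsub>R\<^esub> free_gen R [] (snd p))"
      unfolding mult one
      by (rule R.add.finprod_mono_neutral_cong_left[symmetric])
         (auto simp: finite_splits free_gen_def car(1)[OF f])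
    then show "(f \<otimes>\<^bsub>?A\<^esub> \<one>\<^bsub>?A\<^esub>) w = f w" using car(1)[OF f] by (simp add: free_gen_def)
  qed
  have ring: "ring ?A"
  proof (rule ringI)
    show "abelian_group ?A" by (rule A.abelian_group_axioms)
    show "Group.monoid ?A" by (rule monoidI) (auto simp: mc onec assoc l_one r_one)
    show "(f \<oplus>\<^bsub>?A\<^esub> g) \<otimes>\<^bsub>?A\<^esub> h = f \<otimes>\<^bsub>?A\<^esub> h \<oplus>\<^bsub>?A\<^esub> g \<otimes>\<^bsub>?A\<^esub> h"
      if "f \<in> carrier ?A" "g \<in> carrier ?A" "h \<in> carrier ?A" for f g h
      by (rule ext) (use that car(1) in \<open>simp add: mult add R.l_distr R.finsum_addf\<close>)
    show "h \<otimes>\<^bsub>?A\<^esub> (f \<oplus>\<^bsub>?A\<^esub> g) = h \<otimes>\<^bsub>?A\<^esub> f \<oplus>\<^bsub>?A\<^esub> h \<otimes>\<^bsub>?A\<^esub> g"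
      if "f \<in> carrier ?A" "g \<in> carrier ?A" "h \<in> carrier ?A" for f g h
      by (rule ext) (use that car(1) in \<open>simp add: mult add R.r_distr R.finsum_addf\<close>)
  qed
  show ?thesis
  proof (intro assoc_algebra.intro assoc_algebra_axioms.intro A.module_axioms ring ext)
    fix r f g w assume a: "r \<in> carrier R" "f \<in> carrier ?A" "g \<in> carrier ?A"
    have "r \<otimes>\<^bsub>R\<^esub> (f \<otimes>\<^bsub>?A\<^esub> g) w =
        (\<Oplus>\<^bsub>R\<^esub>p\<in>{p. fst p @ snd p = w}. r \<otimes>\<^bsub>R\<^esub> (f (fst p) \<otimes>\<^bsub>R\<^esub> g (snd p)))"
      unfolding mult by (rule R.finsum_rdistr) (use a car(1) finite_splits in auto)
    then show "((r \<odot>\<^bsub>?A\<^esub> f) \<otimes>\<^bsub>?A\<^esub> g) w = (r \<odot>\<^bsub>?A\<^esub> (f \<otimes>\<^bsub>?A\<^esub> g)) w"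
      and "(f \<otimes>\<^bsub>?A\<^esub> (r \<odot>\<^bsub>?A\<^esub> g)) w = (r \<odot>\<^bsub>?A\<^esub> (f \<otimes>\<^bsub>?A\<^esub> g)) w"
      using a car(1) by (simp_all add: smult) (simp_all add: mult smult R.m_assoc R.m_lcomm)
  qed
qed

lemma ideal_submodule:
  assumes "assoc_algebra R A" "ideal I A"
  shows "submodule I R A"
proof -
  interpret A: assoc_algebra R A by fact
  interpret I: ideal I A by fact
  have "r \<odot>\<^bsub>A\<^esub> x \<in> I" if "r \<in> carrier R" "x \<in> I" for r x
  proof -
    have "r \<odot>\<^bsub>A\<^esub> x = (r \<odot>\<^bsub>A\<^esub> \<one>\<^bsub>A\<^esub>) \<otimes>\<^bsub>A\<^esub> x"
      using that by (simp add: A.smult_mult_l)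
    then show ?thesis using that I.I_l_closed[of x "r \<odot>\<^bsub>A\<^esub> \<one>\<^bsub>A\<^esub>"] by simp
  qed
  then show ?thesis
    by (intro A.submoduleI) (use I.a_subset in auto)
qed

lemma quot_algebra_simps:
  "carrier (quot_algebra A I) = carrier (quot_module A I)"
  "add (quot_algebra A I) = add (quot_module A I)"
  "zero (quot_algebra A I) = zero (quot_module A I)"
  "smult (quot_algebra A I) = smult (quot_module A I)"
  "mult (quot_algebra A I) = rcoset_mult A I"
  "one (quot_algebra A I) = I +>\<^bsub>A\<^esub> \<one>\<^bsub>A\<^esub>"
  by (simp_all add: quot_algebra_def FactRing_def)

lemma quot_algebra_assoc_algebra:
  assumes "assoc_algebra R A" "ideal I A"
  shows "assoc_algebra R (quot_algebra A I)"
proof -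
  interpret A: assoc_algebra R A by fact
  interpret I: ideal I A by fact
  note sub = ideal_submodule[OF assms]
  note [simp] = quot_algebra_simps quot_module_carrier I.rcoset_mult_add
    quot_module_add[OF A.module_axioms sub] quot_module_smult[OF A.module_axioms sub]
  have mod: "module R (quot_algebra A I)"
    unfolding quot_algebra_def by (intro module_upd quot_module_module A.module_axioms sub)
  then have ring: "ring (quot_algebra A I)"
    by (intro ringI monoidI) (auto simp: module_def A.A.m_assoc A.A.l_distr A.A.r_distr)
  show ?thesis
    by (intro assoc_algebra.intro assoc_algebra_axioms.intro mod ring)
       (auto simp: A.smult_mult_l A.smult_mult_r)
qed

lemma quot_algebra_proj:
  assumes "assoc_algebra R A" "ideal I A"
  shows "(\<lambda>x. I +>\<^bsub>A\<^esub> x) \<in> lin_hom R A (quot_algebra A I)"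
    and "\<lbrakk>x \<in> carrier A; y \<in> carrier A\<rbrakk> \<Longrightarrow>
      I +>\<^bsub>A\<^esub> (x \<otimes>\<^bsub>A\<^esub> y) = (I +>\<^bsub>A\<^esub> x) \<otimes>\<^bsub>quot_algebra A I\<^esub> (I +>\<^bsub>A\<^esub> y)"
    and "x \<in> I \<Longrightarrow> I +>\<^bsub>A\<^esub> x = \<zero>\<^bsub>quot_algebra A I\<^esub>"
proof -
  interpret A: assoc_algebra R A by fact
  interpret I: ideal I A by fact
  note sub = ideal_submodule[OF assms]
  show "(\<lambda>x. I +>\<^bsub>A\<^esub> x) \<in> lin_hom R A (quot_algebra A I)"
    using quot_module_proj[OF A.module_axioms sub] by (simp add: lin_hom_def quot_algebra_simps)
  show "\<lbrakk>x \<in> carrier A; y \<in> carrier A\<rbrakk> \<Longrightarrow>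
      I +>\<^bsub>A\<^esub> (x \<otimes>\<^bsub>A\<^esub> y) = (I +>\<^bsub>A\<^esub> x) \<otimes>\<^bsub>quot_algebra A I\<^esub> (I +>\<^bsub>A\<^esub> y)"
    by (simp add: quot_algebra_simps I.rcoset_mult_add)
  show "x \<in> I \<Longrightarrow> I +>\<^bsub>A\<^esub> x = \<zero>\<^bsub>quot_algebra A I\<^esub>"
    using quot_module_proj_zero[OF A.module_axioms sub] by (simp add: quot_algebra_simps)
qed

lemma free_algebra_gen_closed:
  assumes "cring R" "x \<in> X"
  shows "free_gen R [x] \<in> carrier (free_algebra R X)"
  using free_gen_closed[OF assms(1), of "[x]" "lists X"] assms(2) by (simp add: free_algebra_def)

lemma tensor_alg_ideal_ideal:
  assumes "module R L"
  shows "ideal (tensor_alg_ideal R L) (free_algebra R (carrier L))"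
    and "tensor_alg_rels R L \<subseteq> tensor_alg_ideal R L"
proof -
  interpret L: module R L by fact
  let ?A = "free_algebra R (carrier L)"
  interpret A: assoc_algebra R ?A by (rule free_algebra_assoc_algebra[OF L.is_cring])
  have "tensor_alg_rels R L \<subseteq> carrier ?A"
    by (auto simp: tensor_alg_rels_def Let_def
        intro!: A.minus_closed A.add.m_closed A.smult_closed free_algebra_gen_closed L.is_cring)
  then show "ideal (tensor_alg_ideal R L) ?A" "tensor_alg_rels R L \<subseteq> tensor_alg_ideal R L"
    unfolding tensor_alg_ideal_def by (rule A.genideal_ideal A.genideal_self)+
qed

lemma tensor_alg_assoc_algebra:
  assumes "module R L"
  shows "assoc_algebra R (tensor_alg R L)"
  unfolding tensor_alg_def
  by (intro quot_algebra_assoc_algebra free_algebra_assoc_algebra tensor_alg_ideal_ideal assms module.axioms(1)[OF assms])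

lemma tensor_alg_incl_lin_hom:
  assumes "module R L"
  shows "tensor_alg_incl R L \<in> lin_hom R L (tensor_alg R L)"
proof -
  interpret L: module R L by fact
  let ?A = "free_algebra R (carrier L)" and ?T = "tensor_alg R L" and ?I = "tensor_alg_ideal R L"
  interpret A: assoc_algebra R ?A by (rule free_algebra_assoc_algebra[OF L.is_cring])
  interpret T: assoc_algebra R ?T by (rule tensor_alg_assoc_algebra[OF assms])
  define p where "p = (\<lambda>x. ?I +>\<^bsub>?A\<^esub> x)"
  have p: "p \<in> lin_hom R ?A ?T" unfolding p_def tensor_alg_def
    by (rule quot_algebra_proj[OF A.assoc_algebra_axioms tensor_alg_ideal_ideal(1)[OF assms]])
  have e[simp]: "free_gen R [x] \<in> carrier ?A" if "x \<in> carrier L" for x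
    by (rule free_algebra_gen_closed[OF L.is_cring that])
  have t: "tensor_alg_incl R L x = p (free_gen R [x])" for x by (simp add: tensor_alg_incl_def p_def)
  have eq: "p f = p g" if "f \<ominus>\<^bsub>?A\<^esub> g \<in> tensor_alg_rels R L" "f \<in> carrier ?A" "g \<in> carrier ?A" for f g
  proof -
    have "f \<ominus>\<^bsub>?A\<^esub> g \<in> ?I"
      using tensor_alg_ideal_ideal(2)[OF assms] that(1) by blast
    then have "p (f \<ominus>\<^bsub>?A\<^esub> g) = \<zero>\<^bsub>?T\<^esub>" unfolding p_def tensor_alg_def
      by (rule quot_algebra_proj[OF A.assoc_algebra_axioms tensor_alg_ideal_ideal(1)[OF assms]])
    then show ?thesis
      using lin_hom_minus[OF A.module_axioms T.module_axioms p that(2,3)] lin_hom_closed[OF p] that(2,3)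
      by (simp add: T.minus_eq_zero_iff)
  qed
  show ?thesis
  proof (rule lin_homI)
    fix x y assume *: "x \<in> carrier L" "y \<in> carrier L"
    have "p (free_gen R [x \<oplus>\<^bsub>L\<^esub> y]) = p (free_gen R [x] \<oplus>\<^bsub>?A\<^esub> free_gen R [y])"
      by (rule eq) (use * in \<open>auto simp: tensor_alg_rels_def Let_def\<close>)
    then show "tensor_alg_incl R L (x \<oplus>\<^bsub>L\<^esub> y) = tensor_alg_incl R L x \<oplus>\<^bsub>?T\<^esub> tensor_alg_incl R L y"
      using * by (simp add: t lin_hom_add[OF p])
  next
    fix r x assume *: "r \<in> carrier R" "x \<in> carrier L"
    have "p (free_gen R [r \<odot>\<^bsub>L\<^esub> x]) = p (r \<odot>\<^bsub>?A\<^esub> free_gen R [x])"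
      by (rule eq) (use * in \<open>auto simp: tensor_alg_rels_def Let_def\<close>)
    then show "tensor_alg_incl R L (r \<odot>\<^bsub>L\<^esub> x) = r \<odot>\<^bsub>?T\<^esub> tensor_alg_incl R L x"
      using * by (simp add: t lin_hom_smult[OF p])
  qed (simp add: t lin_hom_closed[OF p])
qed

lemma uea_ideal_ideal:
  assumes "lie_algebra R L"
  shows "ideal (uea_ideal R L) (tensor_alg R L)"
    and "\<lbrakk>x \<in> carrier L; y \<in> carrier L\<rbrakk> \<Longrightarrow>
      tensor_alg_incl R L x \<otimes>\<^bsub>tensor_alg R L\<^esub> tensor_alg_incl R L y
      \<ominus>\<^bsub>tensor_alg R L\<^esub> tensor_alg_incl R L y \<otimes>\<^bsub>tensor_alg R L\<^esub> tensor_alg_incl R L x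
      \<ominus>\<^bsub>tensor_alg R L\<^esub> tensor_alg_incl R L (bracket L x y) \<in> uea_ideal R L"
proof -
  interpret L: lie_algebra R L by fact
  let ?T = "tensor_alg R L" and ?i = "tensor_alg_incl R L"
  interpret T: assoc_algebra R ?T by (rule tensor_alg_assoc_algebra[OF L.module_axioms])
  note ic = lin_hom_closed[OF tensor_alg_incl_lin_hom[OF L.module_axioms]]
  let ?S = "{?i x \<otimes>\<^bsub>?T\<^esub> ?i y \<ominus>\<^bsub>?T\<^esub> ?i y \<otimes>\<^bsub>?T\<^esub> ?i x \<ominus>\<^bsub>?T\<^esub> ?i (bracket L x y) | x y.
      x \<in> carrier L \<and> y \<in> carrier L}"
  have S: "?S \<subseteq> carrier ?T" using ic L.bracket_closed by (auto intro!: T.minus_closed)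
  have u: "uea_ideal R L = Idl\<^bsub>?T\<^esub> ?S" by (simp add: uea_ideal_def Let_def)
  show "ideal (uea_ideal R L) ?T" unfolding u by (rule T.genideal_ideal[OF S])
  assume "x \<in> carrier L" "y \<in> carrier L"
  then show "?i x \<otimes>\<^bsub>?T\<^esub> ?i y \<ominus>\<^bsub>?T\<^esub> ?i y \<otimes>\<^bsub>?T\<^esub> ?i x \<ominus>\<^bsub>?T\<^esub> ?i (bracket L x y) \<in> uea_ideal R L"
    unfolding u by (intro subsetD[OF T.genideal_self[OF S]]) blast
qed

lemma uea_assoc_algebra:
  assumes "lie_algebra R L"
  shows "assoc_algebra R (uea R L)"
  unfolding uea_def
  by (intro quot_algebra_assoc_algebra tensor_alg_assoc_algebra uea_ideal_ideal assms lie_algebra.axioms(1))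

lemma uea_map_hom:
  assumes "lie_algebra R L"
  shows "uea_map R L \<in> lin_hom R L (uea R L)"
    and "\<lbrakk>x \<in> carrier L; y \<in> carrier L\<rbrakk> \<Longrightarrow> uea_map R L (bracket L x y) =
      uea_map R L x \<otimes>\<^bsub>uea R L\<^esub> uea_map R L y \<ominus>\<^bsub>uea R L\<^esub> uea_map R L y \<otimes>\<^bsub>uea R L\<^esub> uea_map R L x"
proof -
  interpret L: lie_algebra R L by fact
  let ?T = "tensor_alg R L" and ?i = "tensor_alg_incl R L" and ?U = "uea R L" and ?J = "uea_ideal R L"
  interpret T: assoc_algebra R ?T by (rule tensor_alg_assoc_algebra[OF L.module_axioms])
  interpret U: assoc_algebra R ?U by (rule uea_assoc_algebra[OF assms])
  note i = tensor_alg_incl_lin_hom[OF L.module_axioms]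
  note pr = quot_algebra_proj[OF T.assoc_algebra_axioms uea_ideal_ideal(1)[OF assms]]
  define p where "p = (\<lambda>x. ?J +>\<^bsub>?T\<^esub> x)"
  have p: "p \<in> lin_hom R ?T ?U" unfolding p_def uea_def by (rule pr(1))
  have pm: "p (x \<otimes>\<^bsub>?T\<^esub> y) = p x \<otimes>\<^bsub>?U\<^esub> p y" if "x \<in> carrier ?T" "y \<in> carrier ?T" for x y
    unfolding p_def uea_def by (rule pr(2)[OF that])
  have pz: "p x = \<zero>\<^bsub>?U\<^esub>" if "x \<in> ?J" for x
    unfolding p_def uea_def by (rule pr(3)[OF that])
  have u: "uea_map R L x = p (?i x)" for x by (simp add: uea_map_def p_def)
  show "uea_map R L \<in> lin_hom R L ?U"
    by (rule lin_homI)
       (simp_all add: u lin_hom_closed[OF i] lin_hom_closed[OF p] lin_hom_add[OF i] lin_hom_add[OF p]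
          lin_hom_smult[OF i] lin_hom_smult[OF p])
  assume xy: "x \<in> carrier L" "y \<in> carrier L"
  note ic = lin_hom_closed[OF i xy(1)] lin_hom_closed[OF i xy(2)] lin_hom_closed[OF i L.bracket_closed[OF xy]]
  note pc = ic[THEN lin_hom_closed[OF p]]
  have "p (?i x) \<otimes>\<^bsub>?U\<^esub> p (?i y) \<ominus>\<^bsub>?U\<^esub> p (?i y) \<otimes>\<^bsub>?U\<^esub> p (?i x) \<ominus>\<^bsub>?U\<^esub> p (?i (bracket L x y)) = \<zero>\<^bsub>?U\<^esub>"
    using pz[OF uea_ideal_ideal(2)[OF assms xy]] ic
    by (simp add: lin_hom_minus[OF T.module_axioms U.module_axioms p] pm T.minus_closed)
  then show "uea_map R L (bracket L x y) =
      uea_map R L x \<otimes>\<^bsub>?U\<^esub> uea_map R L y \<ominus>\<^bsub>?U\<^esub> uea_map R L y \<otimes>\<^bsub>?U\<^esub> uea_map R L x"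
    unfolding u using pc by (simp add: U.minus_eq_zero_iff U.minus_closed)
qed

end

theory Submission
  imports Defs
begin

text \<open>On \<open>\<Lambda>\<^sup>2M\<close> the canonical map \<open>\<phi>\<close> factors through \<open>\<partial>\<close>: writing \<open>\<mu>\<close> for the linear map
  \<open>M \<otimes> M \<rightarrow> U\<gg>\<close> with \<open>\<mu> (a \<otimes> b) = \<phi> a \<cdot> \<phi> b\<close>, one has
  \<open>\<phi> (a \<and> b) = \<phi> [a, b] = \<phi> a \<cdot> \<phi> b - \<phi> b \<cdot> \<phi> a = \<mu> (\<partial> (a \<and> b))\<close>.\<close>

lemma lin_hom_comp:
  assumes "f \<in> lin_hom R M N" and "g \<in> lin_hom R N P"
  shows "g \<circ> f \<in> lin_hom R M P"
  using assms by (auto simp: lin_hom_def Pi_iff)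

text \<open>The image of \<open>M\<close> is a submodule but in general no Lie subalgebra: brackets
  of its elements land in the summand \<open>ext_square R M\<close>.\<close>

lemma wedge_lie_inl:
  assumes "module R M"
  shows "(\<lambda>a. (a, \<zero>\<^bsub>ext_square R M\<^esub>)) \<in> lin_hom R M (wedge_lie R M)"
proof -
  interpret E: module R "ext_square R M" by (rule ext_square_module[OF assms])
  show ?thesis by (rule lin_homI) (auto simp: wedge_lie_def Let_def)
qed

lemma wedge_lie_inr:
  assumes "module R M"
  shows "(\<lambda>\<alpha>. (\<zero>\<^bsub>M\<^esub>, \<alpha>)) \<in> lin_hom R (ext_square R M) (wedge_lie R M)"
proof -
  interpret M: module R M by fact
  show ?thesis by (rule lin_homI) (auto simp: wedge_lie_def Let_def)
qed

text \<open>Distributivity in \<open>A\<close> and the passage of scalars through either factor of a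
  product make \<open>f x\<close> times \<open>g y\<close> bilinear in \<open>x\<close> and
  \<open>y\<close>, so the universal property of the tensor product applies.\<close>

lemma tensor_lift_mult:
  assumes "module R M" and "module R N" and "assoc_algebra R A"
    and f: "f \<in> lin_hom R M A" and g: "g \<in> lin_hom R N A"
  obtains h where "h \<in> lin_hom R (tensor_prod R M N) A"
    and "\<And>x y. \<lbrakk>x \<in> carrier M; y \<in> carrier N\<rbrakk> \<Longrightarrow> h (tensor R M N x y) = f x \<otimes>\<^bsub>A\<^esub> g y"
proof -
  interpret A: assoc_algebra R A by fact
  note closed = lin_hom_closed[OF f] lin_hom_closed[OF g]
  show thesis
    by (rule tensor_lift[OF assms(1,2) A.module_axioms, of "\<lambda>x y. f x \<otimes>\<^bsub>A\<^esub> g y"])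
       (simp_all add: closed lin_hom_add[OF f] lin_hom_add[OF g] lin_hom_smult[OF f]
          lin_hom_smult[OF g] A.A.l_distr A.A.r_distr A.smult_mult_l A.smult_mult_r that)
qed

text \<open>The equalizer of two linear maps is a submodule, and the pure wedges generate the
  exterior square.\<close>

lemma lin_hom_ext_square_eqI:
  assumes "module R M" and "module R P"
    and f: "f \<in> lin_hom R (ext_square R M) P" and g: "g \<in> lin_hom R (ext_square R M) P"
    and eq: "\<And>a b. \<lbrakk>a \<in> carrier M; b \<in> carrier M\<rbrakk> \<Longrightarrow> f (wedge R M a b) = g (wedge R M a b)"
    and "\<alpha> \<in> carrier (ext_square R M)"
  shows "f \<alpha> = g \<alpha>"
proof -
  have "carrier (ext_square R M) \<subseteq> {\<alpha> \<in> carrier (ext_square R M). f \<alpha> = g \<alpha>}"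
    by (rule wedge_induct[OF assms(1)
          lin_hom_eq_on_submodule[OF ext_square_module[OF assms(1)] assms(2) f g]])
       (simp add: eq wedge_closed[OF assms(1)])
  then show ?thesis using assms(6) by blast
qed

text \<open>The conclusion keeps \<mu> as a bare function: to pass from equal boundaries to equal
  images, it is enough that \<mu> is a function.\<close>

lemma uea_map_factors_wedge_bdry:
  fixes R :: "('k, 'c) ring_scheme" and M :: "('k, 'a, 'd) module_scheme"
  assumes M: "module R M"
  obtains \<mu> where "\<And>\<alpha>. \<alpha> \<in> carrier (ext_square R M) \<Longrightarrow>
    uea_map R (wedge_lie R M) (\<zero>\<^bsub>M\<^esub>, \<alpha>) = \<mu> (wedge_bdry R M \<alpha>)"
proof -
  let ?L = "wedge_lie R M" and ?U = "uea R (wedge_lie R M)" and ?T = "tensor_prod R M M"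
    and ?\<phi> = "uea_map R (wedge_lie R M)"
  let ?i = "?\<phi> \<circ> (\<lambda>a. (a, \<zero>\<^bsub>ext_square R M\<^esub>))" and ?j = "?\<phi> \<circ> (\<lambda>\<alpha>. (\<zero>\<^bsub>M\<^esub>, \<alpha>))"
  note L = wedge_lie_lie_algebra[OF M]
  interpret U: assoc_algebra R ?U by (rule uea_assoc_algebra[OF L])
  have i: "?i \<in> lin_hom R M ?U"
    by (rule lin_hom_comp[OF wedge_lie_inl[OF M] uea_map_hom(1)[OF L]])
  have j: "?j \<in> lin_hom R (ext_square R M) ?U"
    by (rule lin_hom_comp[OF wedge_lie_inr[OF M] uea_map_hom(1)[OF L]])
  obtain \<mu> where \<mu>: "\<mu> \<in> lin_hom R ?T ?U"
    and \<mu>_tensor: "\<And>a b. \<lbrakk>a \<in> carrier M; b \<in> carrier M\<rbrakk> \<Longrightarrow>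
      \<mu> (tensor R M M a b) = ?i a \<otimes>\<^bsub>?U\<^esub> ?i b"
    using tensor_lift_mult[OF M M U.assoc_algebra_axioms i i] by blast
  \<comment> \<open>Both sides are linear in the element of the exterior square, so a comparison on
    pure wedges suffices.\<close>
  have "?j (wedge R M a b) = (\<mu> \<circ> wedge_bdry R M) (wedge R M a b)"
    if a: "a \<in> carrier M" and b: "b \<in> carrier M" for a b
  proof -
    \<comment> \<open>The pair with entries zero and \<open>wedge R M a b\<close> is itself a
      bracket of two elements coming from \<open>M\<close>, so the defining relation of the
      enveloping algebra turns its image into a commutator.\<close>
    have "?j (wedge R M a b) =
        ?\<phi> (bracket ?L (a, \<zero>\<^bsub>ext_square R M\<^esub>) (b, \<zero>\<^bsub>ext_square R M\<^esub>))"
      by (simp add: wedge_lie_def Let_def)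
    also have "\<dots> = ?i a \<otimes>\<^bsub>?U\<^esub> ?i b \<ominus>\<^bsub>?U\<^esub> ?i b \<otimes>\<^bsub>?U\<^esub> ?i a"
      using uea_map_hom(2)[OF L lin_hom_closed[OF wedge_lie_inl[OF M] a]
          lin_hom_closed[OF wedge_lie_inl[OF M] b]] by simp
    also have "\<dots> = \<mu> (tensor R M M a b \<ominus>\<^bsub>?T\<^esub> tensor R M M b a)"
      using a b by (simp add: \<mu>_tensor tensor_closed[OF M M]
          lin_hom_minus[OF tensor_prod_module[OF M M] U.module_axioms \<mu>])
    finally show ?thesis using wedge_bdry(2)[OF M a b] by simp
  qed
  then have "?j \<alpha> = (\<mu> \<circ> wedge_bdry R M) \<alpha>" if "\<alpha> \<in> carrier (ext_square R M)" for \<alpha>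
    using lin_hom_ext_square_eqI[OF M U.module_axioms j lin_hom_comp[OF wedge_bdry(1)[OF M] \<mu>]]
      that by blast
  then show thesis by (intro that[of \<mu>]) simp
qed

theorem proposition9p1:
  fixes R :: "('k, 'c) ring_scheme" and M :: "('k, 'a, 'd) module_scheme"
  assumes "cring R" and "module R M"
    and "\<not> inj_on (wedge_bdry R M) (carrier (ext_square R M))"
  shows "\<not> inj_on (uea_map R (wedge_lie R M)) (carrier (wedge_lie R M))"
proof
  assume inj: "inj_on (uea_map R (wedge_lie R M)) (carrier (wedge_lie R M))"
  obtain \<mu> where \<mu>: "\<And>\<alpha>. \<alpha> \<in> carrier (ext_square R M) \<Longrightarrow>
      uea_map R (wedge_lie R M) (\<zero>\<^bsub>M\<^esub>, \<alpha>) = \<mu> (wedge_bdry R M \<alpha>)"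
    using uea_map_factors_wedge_bdry[OF assms(2)] by blast
  have "inj_on (wedge_bdry R M) (carrier (ext_square R M))"
  proof (rule inj_onI)
    fix \<alpha> \<beta>
    assume \<alpha>: "\<alpha> \<in> carrier (ext_square R M)" and \<beta>: "\<beta> \<in> carrier (ext_square R M)"
      and "wedge_bdry R M \<alpha> = wedge_bdry R M \<beta>"
    then have "uea_map R (wedge_lie R M) (\<zero>\<^bsub>M\<^esub>, \<alpha>) = uea_map R (wedge_lie R M) (\<zero>\<^bsub>M\<^esub>, \<beta>)"
      by (simp add: \<mu>)
    \<comment> \<open>Injectivity is applied to two elements of the summand
      \<open>ext_square R M\<close>; equality of the pairs then gives equality of their second
      entries.\<close>
    then show "\<alpha> = \<beta>"
      using inj_onD[OF inj] lin_hom_closed[OF wedge_lie_inr[OF assms(2)]] \<alpha> \<beta> by blast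
  qed
  then show False using assms(3) by contradiction
qed

end
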